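(* Let $n\ge2$, $U\subset\mathbb{R}^m$, and let $u\mapsto H(u)$ be a smooth map from $U$ to the $n\times n$ Hermitian matrices (not necessarily affine in $u$). Let $\mathscr G=\mathrm{SU}(n)$ if $\operatorname{tr}H(u)=0$ for all $u\in U$, and $\mathscr G=\mathrm{U}(n)$ otherwise. Then the system $i\dot\psi(t)=H(u(t))\psi(t)$, $\psi(t)\in S^{2n-1}\subset\mathbb{C}^n$, $u(t)\in U$, is approximately controllable if and only if it is exactly controllable. Likewise, the system $i\dot g(t)=H(u(t))g(t)$, $g(t)\in\mathscr G$, $u(t)\in U$, is approximately controllable if and only if it is exactly controllable.
   Context: Controls are $L^\infty$ functions $u:[0,T]\to U$. For a control system on a connected manifold $M$, the reachable set from $q_0$ is the set of endpoints $q(T)$, $T\ge0$, of solutions starting at $q_0$ with admissible controls; the system is exactly controllable if the reachable set from every $q_0\in M$ is $M$, and approximately controllable if the reachable set from every $q_0\in M$ is dense in $M$. *)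

theory Defs
  imports "HOL-Analysis.Analysis"
begin

(* C^infinity on an open set S: a family D of iterated directional derivatives,
   D [] = f on S, and each D vs is Frechet differentiable at every point of S
   with derivative v |-> D (v # vs). *)
definition smooth_on_open :: "('a::real_normed_vector \<Rightarrow> 'b::real_normed_vector) \<Rightarrow> 'a set \<Rightarrow> bool" where
  "smooth_on_open f S \<longleftrightarrow> open S \<and>
     (\<exists>D :: 'a list \<Rightarrow> 'a \<Rightarrow> 'b. (\<forall>x\<in>S. D [] x = f x) \<and>
        (\<forall>vs. \<forall>x\<in>S. (D vs has_derivative (\<lambda>v. D (v # vs) x)) (at x)))"

definition smooth_on :: "('a::real_normed_vector \<Rightarrow> 'b::real_normed_vector) \<Rightarrow> 'a set \<Rightarrow> bool" where
  "smooth_on f U \<longleftrightarrow> (\<exists>V F. U \<subseteq> V \<and> smooth_on_open F V \<and> (\<forall>x\<in>U. F x = f x))"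

definition adjoint_mat :: "complex^'n^'n \<Rightarrow> complex^'n^'n" where
  "adjoint_mat A = (\<chi> i j. cnj (A $ j $ i))"

definition hermitian :: "complex^'n^'n \<Rightarrow> bool" where
  "hermitian A \<longleftrightarrow> adjoint_mat A = A"

definition unitary_group :: "(complex^'n^'n) set" where
  "unitary_group = {g. g ** adjoint_mat g = mat 1}"

definition special_unitary_group :: "(complex^'n^'n) set" where
  "special_unitary_group = {g. g \<in> unitary_group \<and> det g = 1}"

definition unit_sphere_C :: "(complex^'n) set" where
  "unit_sphere_C = {\<psi>. norm \<psi> = 1}"

definition admissible_control :: "'u::euclidean_space set \<Rightarrow> real \<Rightarrow> (real \<Rightarrow> 'u) \<Rightarrow> bool" where
  "admissible_control U T u \<longleftrightarrow>
     u \<in> borel_measurable (lebesgue_on {0..T}) \<and>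
     (\<exists>B. AE t in lebesgue_on {0..T}. norm (u t) \<le> B) \<and>
     (\<forall>t\<in>{0..T}. u t \<in> U)"

(* Caratheodory solution of q' = f(u,q) on [0,T], starting at q0, staying in M *)
definition is_solution ::
  "('u::euclidean_space \<Rightarrow> 'x::euclidean_space \<Rightarrow> 'x) \<Rightarrow> 'x set \<Rightarrow> real \<Rightarrow> (real \<Rightarrow> 'u) \<Rightarrow> 'x \<Rightarrow> (real \<Rightarrow> 'x) \<Rightarrow> bool" where
  "is_solution f M T u q0 q \<longleftrightarrow>
     q 0 = q0 \<and> (\<forall>t\<in>{0..T}. q t \<in> M) \<and>
     (\<lambda>s. f (u s) (q s)) absolutely_integrable_on {0..T} \<and>
     (\<forall>t\<in>{0..T}. ((\<lambda>s. f (u s) (q s)) has_integral (q t - q0)) {0..t})"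

definition reachable_set ::
  "('u::euclidean_space \<Rightarrow> 'x::euclidean_space \<Rightarrow> 'x) \<Rightarrow> 'x set \<Rightarrow> 'u set \<Rightarrow> 'x \<Rightarrow> 'x set" where
  "reachable_set f M U q0 =
     {q T | T u q. 0 \<le> T \<and> admissible_control U T u \<and> is_solution f M T u q0 q}"

definition exactly_controllable ::
  "('u::euclidean_space \<Rightarrow> 'x::euclidean_space \<Rightarrow> 'x) \<Rightarrow> 'x set \<Rightarrow> 'u set \<Rightarrow> bool" where
  "exactly_controllable f M U \<longleftrightarrow> (\<forall>q0\<in>M. reachable_set f M U q0 = M)"

definition approximately_controllable ::
  "('u::euclidean_space \<Rightarrow> 'x::euclidean_space \<Rightarrow> 'x) \<Rightarrow> 'x set \<Rightarrow> 'u set \<Rightarrow> bool" where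
  "approximately_controllable f M U \<longleftrightarrow>
     (\<forall>q0\<in>M. reachable_set f M U q0 \<subseteq> M \<and> M \<subseteq> closure (reachable_set f M U q0))"

end

theory Submission
  imports Defs
begin

text \<open>
  Put \<open>X u = -i H(u)\<close>, let \<open>S\<close> be the semigroup generated by the flows \<open>exp(t X u)\<close>, \<open>t > 0\<close>, and let \<open>W\<close> be the real
  span of all \<open>h\<^sup>* (X u) h\<close> with \<open>h\<close> in \<open>S\<close>; it is the Lie algebra generated by the \<open>X u\<close>. Every reachable point lies
  in the orbit of the compact group \<open>K\<close> of unitary matrices that normalize \<open>W\<close> and commute with its commutant, so
  approximate controllability makes \<open>K\<close> transitive on the sphere, respectively larger than \<open>SU(n)\<close>.

  On the group, \<open>W\<close> is then normalized by \<open>su(n)\<close> and its orthogonal complement consists of scalars, so \<open>W\<close> is \<open>su(n)\<close>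
  or \<open>u(n)\<close>. On the sphere, Schur's lemma shows that the normalizer of \<open>W\<close> in \<open>u(n)\<close> is \<open>W + iR\<close>; transitivity of \<open>K\<close>
  gives \<open>W \<psi> + iR \<psi> = T\<^sub>\<psi>\<close>, and \<open>i \<psi>\<close> lies in \<open>W \<psi>\<close> because a nonzero element of \<open>W\<close> has an eigenvector with nonzero
  eigenvalue, which \<open>K\<close> moves to \<open>\<psi>\<close>. In both cases \<open>W\<close> acts transitively on tangent spaces, hence the set of points that
  can be steered exactly to a given target has an interior point, and the dense reachable sets meet it.
\<close>

section \<open>Complex matrices\<close>

text \<open>Trajectories only run forward in time, so \<open>S\<close> has no inverses; finite
  dimension and compactness replace them. Conjugation by an element of \<open>S\<close> maps
  \<open>W\<close> injectively into itself, hence onto, and the orbits of the compact group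
  \<open>K\<close> are closed, so a dense reachable set forces an orbit to be everything.
  \<open>K\<close> is deliberately large: it is cut out by closed conditions and may contain much
  more than the system generates. The price is that knowledge of \<open>K\<close> has to be brought
  back to \<open>W\<close>. The bridge is that \<open>lie_bracket A\<close> is skew for the real
  trace inner product when \<open>A\<close> is skew-Hermitian: a matrix that normalizes
  \<open>W\<close> and is orthogonal to it commutes with it, and then the commutant condition and
  the size of \<open>K\<close> make it a scalar. Tangent directions are limits of difference
  quotients, and no structure theory of Lie groups enters. The interior point comes from one finite
  product of flows whose velocities span \<open>W\<close>: its durations are strictly positive, so
  they may be varied both ways without leaving \<open>S\<close>.\<close>

lemma bounded_bilinear_matrix_mult:
  "bounded_bilinear ((**) :: complex^'n^'n \<Rightarrow> complex^'n^'n \<Rightarrow> complex^'n^'n)"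
  unfolding bilinear_conv_bounded_bilinear[symmetric] bilinear_def
  by (auto intro!: linearI simp: matrix_matrix_mult_def vec_eq_iff sum.distrib algebra_simps scaleR_sum_right)

lemma bounded_bilinear_matrix_vector_mult:
  "bounded_bilinear ((*v) :: complex^'n^'n \<Rightarrow> complex^'n \<Rightarrow> complex^'n)"
  unfolding bilinear_conv_bounded_bilinear[symmetric] bilinear_def
  by (auto intro!: linearI simp: matrix_vector_mult_def vec_eq_iff sum.distrib algebra_simps scaleR_sum_right)

lemma bounded_linear_adjoint_mat: "bounded_linear (adjoint_mat :: complex^'n^'n \<Rightarrow> _)"
  unfolding linear_conv_bounded_linear[symmetric]
  by (auto intro!: linearI simp: adjoint_mat_def vec_eq_iff)

interpretation mm: bounded_bilinear "(**) :: complex^'n^'n \<Rightarrow> complex^'n^'n \<Rightarrow> complex^'n^'n"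
  by (rule bounded_bilinear_matrix_mult)

interpretation mv: bounded_bilinear "(*v) :: complex^'n^'n \<Rightarrow> complex^'n \<Rightarrow> complex^'n"
  by (rule bounded_bilinear_matrix_vector_mult)

lemmas adj_add = linear_add[OF bounded_linear.linear[OF bounded_linear_adjoint_mat]]
  and adj_diff = linear_diff[OF bounded_linear.linear[OF bounded_linear_adjoint_mat]]
  and adj_scaleR = linear_scale[OF bounded_linear.linear[OF bounded_linear_adjoint_mat]]
  and adj_zero = linear_0[OF bounded_linear.linear[OF bounded_linear_adjoint_mat]]
  and adj_tendsto = bounded_linear.tendsto[OF bounded_linear_adjoint_mat]
  and adj_continuous_on = bounded_linear.continuous_on[OF bounded_linear_adjoint_mat]
  and adj_has_derivative = bounded_linear.has_derivative[OF bounded_linear_adjoint_mat]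
  and adj_has_vector_derivative = bounded_linear.has_vector_derivative[OF bounded_linear_adjoint_mat]

lemma adjoint_mat_mult: "adjoint_mat (A ** B) = adjoint_mat B ** adjoint_mat A"
  for A B :: "complex^'n^'n"
  by (simp add: adjoint_mat_def matrix_matrix_mult_def vec_eq_iff mult.commute)

lemma adjoint_mat_adjoint_mat [simp]: "adjoint_mat (adjoint_mat A) = A"
  by (simp add: adjoint_mat_def vec_eq_iff)

lemma adjoint_mat_mat [simp]: "adjoint_mat (mat c) = mat (cnj c)"
  by (simp add: adjoint_mat_def mat_def vec_eq_iff)

lemma inner_complex_cnj: "x \<bullet> y = Re (x * cnj y)"
  by (simp add: inner_complex_def)

lemma inner_matrix_vector_mult: "(A *v x) \<bullet> y = x \<bullet> (adjoint_mat A *v y)"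
  for A :: "complex^'n^'n"
proof -
  have "(A *v x) \<bullet> y = (\<Sum>i\<in>UNIV. \<Sum>j\<in>UNIV. Re (A$i$j * x$j * cnj (y$i)))"
    by (simp add: inner_vec_def inner_complex_cnj matrix_vector_mult_def sum_distrib_right)
  also have "\<dots> = (\<Sum>j\<in>UNIV. \<Sum>i\<in>UNIV. Re (A$i$j * x$j * cnj (y$i)))"
    by (rule sum.swap)
  also have "\<dots> = x \<bullet> (adjoint_mat A *v y)"
    by (simp add: inner_vec_def inner_complex_cnj matrix_vector_mult_def adjoint_mat_def
        sum_distrib_left mult_ac)
  finally show ?thesis .
qed

lemma inner_matrix: "A \<bullet> B = Re (trace (A ** adjoint_mat B))" for A B :: "complex^'n^'n"
  by (simp add: inner_vec_def inner_complex_cnj trace_def matrix_matrix_mult_def adjoint_mat_def)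

lemma inner_matrix_mult_left: "(A ** B) \<bullet> C = B \<bullet> (adjoint_mat A ** C)"
  for A B C :: "complex^'n^'n"
proof -
  have "trace (A ** B ** adjoint_mat C) = trace (A ** (B ** adjoint_mat C))"
    by (simp add: matrix_mul_assoc)
  also have "\<dots> = trace (B ** adjoint_mat (adjoint_mat A ** C))"
    by (subst trace_mul_sym) (simp add: adjoint_mat_mult matrix_mul_assoc)
  finally show ?thesis by (simp add: inner_matrix)
qed

lemma inner_matrix_mult_right: "(A ** B) \<bullet> C = A \<bullet> (C ** adjoint_mat B)"
  for A B C :: "complex^'n^'n"
  by (simp add: inner_matrix adjoint_mat_mult matrix_mul_assoc)

lemma unitary_group_iff: "g \<in> unitary_group \<longleftrightarrow> adjoint_mat g ** g = mat 1"
  for g :: "complex^'n^'n"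
  unfolding unitary_group_def using matrix_left_right_inverse by auto

lemma unitary_cancel:
  fixes g A :: "complex^'n^'n"
  assumes "g \<in> unitary_group"
  shows "adjoint_mat g ** g = mat 1" "g ** adjoint_mat g = mat 1"
    "adjoint_mat g ** (g ** A) = A" "g ** (adjoint_mat g ** A) = A"
    "adjoint_mat g *v (g *v x) = x" "g *v (adjoint_mat g *v x) = x"
  using assms unitary_group_iff[of g]
  by (auto simp: unitary_group_def matrix_mul_assoc matrix_vector_mul_assoc)

lemma unitary_one [simp]: "mat 1 \<in> unitary_group"
  by (simp add: unitary_group_def)

lemma unitary_mult:
  "g \<in> unitary_group \<Longrightarrow> h \<in> unitary_group \<Longrightarrow> g ** h \<in> unitary_group"
  by (simp add: unitary_group_iff adjoint_mat_mult unitary_cancel matrix_mul_assoc[symmetric])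

lemma unitary_adjoint_mat: "g \<in> unitary_group \<Longrightarrow> adjoint_mat g \<in> unitary_group"
  by (simp add: unitary_group_iff unitary_cancel)

lemma norm_unitary_vector: "g \<in> unitary_group \<Longrightarrow> norm (g *v x) = norm x"
  by (simp add: norm_eq_sqrt_inner inner_matrix_vector_mult unitary_cancel)

lemma norm_unitary_left: "g \<in> unitary_group \<Longrightarrow> norm (g ** A) = norm A" for A :: "complex^'n^'n"
  by (simp add: norm_eq_sqrt_inner inner_matrix_mult_left unitary_cancel)

lemma norm_unitary_right: "g \<in> unitary_group \<Longrightarrow> norm (A ** g) = norm A" for A :: "complex^'n^'n"
  by (simp add: norm_eq_sqrt_inner inner_matrix_mult_right unitary_cancel flip: matrix_mul_assoc)

lemma closed_unitary_group: "closed (unitary_group :: (complex^'n^'n) set)"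
  unfolding unitary_group_def
  by (intro closed_Collect_eq continuous_intros mm.continuous_on adj_continuous_on)

lemma bounded_unitary_group: "bounded (unitary_group :: (complex^'n^'n) set)"
  unfolding bounded_iff
  by (intro exI[of _ "norm (mat 1 :: complex^'n^'n)"])
    (metis matrix_mul_rid norm_unitary_left order_refl)

section \<open>Skew-Hermitian matrices, commutators and scalar matrices\<close>

definition skew_hermitian :: "complex^'n^'n \<Rightarrow> bool" where
  "skew_hermitian A \<longleftrightarrow> adjoint_mat A = - A"

definition lie_bracket :: "complex^'n^'n \<Rightarrow> complex^'n^'n \<Rightarrow> complex^'n^'n" where
  "lie_bracket A B = A ** B - B ** A"

text \<open>The adjoint of left or right multiplication by \<open>A\<close> is multiplication by its
  conjugate transpose, here \<open>- A\<close>; so bracketing with \<open>A\<close> is a skew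
  operator on matrices.\<close>

lemma inner_lie_bracket:
  assumes "skew_hermitian A"
  shows "lie_bracket A B \<bullet> C = - (B \<bullet> lie_bracket A C)"
  using assms unfolding lie_bracket_def skew_hermitian_def
  by (simp add: inner_diff_left inner_diff_right inner_matrix_mult_left[of A] inner_matrix_mult_right[of _ A]
      mm.minus_left mm.minus_right)

lemma lie_bracket_commute: "lie_bracket A B = - lie_bracket B A"
  by (simp add: lie_bracket_def)

lemma lie_bracket_simps:
  "lie_bracket (A + B) C = lie_bracket A C + lie_bracket B C"
  "lie_bracket (A - B) C = lie_bracket A C - lie_bracket B C"
  "lie_bracket (r *\<^sub>R A) C = r *\<^sub>R lie_bracket A C"
  "lie_bracket 0 C = 0"
  by (simp_all add: lie_bracket_def mm.add_left mm.add_right mm.diff_left mm.diff_right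
      mm.scaleR_left mm.scaleR_right algebra_simps)

lemma skew_hermitian_inner_zero: "skew_hermitian A \<Longrightarrow> (A *v x) \<bullet> x = 0"
  using inner_matrix_vector_mult[of A x x]
  by (simp add: skew_hermitian_def mv.minus_left inner_commute)

lemma mat_mult_commute: "mat c ** A = A ** mat c" for A :: "complex^'n^'n"
  by (simp add: matrix_matrix_mult_def mat_def vec_eq_iff if_distrib[where f="\<lambda>x. x * _"]
      if_distrib[where f="\<lambda>x. _ * x"] mult.commute cong: if_cong)

lemma mat_mult_nth: "(mat c ** A) $ i $ j = c * A $ i $ j" for A :: "complex^'n^'n"
  by (simp add: matrix_matrix_mult_def mat_def if_distrib[where f="\<lambda>x. x * _"] cong: if_cong)

lemma mat_vector_mult: "mat c *v x = c *s x" for x :: "complex^'n"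
  by (simp add: matrix_vector_mult_def mat_def vec_eq_iff if_distrib[where f="\<lambda>x. x * _"] cong: if_cong)

section \<open>The matrix exponential\<close>

lemma has_vector_derivative_matrix:
  fixes f :: "real \<Rightarrow> complex^'n^'n"
  assumes "\<And>i j. ((\<lambda>t. f t $ i $ j) has_vector_derivative f' $ i $ j) (at t)"
  shows "(f has_vector_derivative f') (at t)"
  unfolding has_vector_derivative_def
proof (subst has_derivative_componentwise_within, rule ballI)
  fix b :: "complex^'n^'n" assume "b \<in> Basis"
  then obtain i j c where b: "b = axis i (axis j c)"
    by (auto simp: Basis_vec_def)
  have "((\<lambda>t. f t $ i $ j \<bullet> c) has_derivative (\<lambda>h. (h *\<^sub>R f' $ i $ j) \<bullet> c)) (at t)"
    using assms[of i j] unfolding has_vector_derivative_def by (rule has_derivative_inner_left)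
  then show "((\<lambda>t. f t \<bullet> b) has_derivative (\<lambda>h. (h *\<^sub>R f') \<bullet> b)) (at t)"
    by (simp add: b inner_axis)
qed

primrec matpow :: "complex^'n^'n \<Rightarrow> nat \<Rightarrow> complex^'n^'n" where
  "matpow A 0 = mat 1"
| "matpow A (Suc k) = A ** matpow A k"

text \<open>This is exp(tA), written as entrywise power series in a complex variable restricted to
  the reals, so that scalar termwise differentiation applies.\<close>

definition matexp :: "complex^'n^'n \<Rightarrow> real \<Rightarrow> complex^'n^'n" where
  "matexp A t = (\<chi> i j. \<Sum>k. (matpow A k $ i $ j / fact k) * of_real t ^ k)"

text \<open>Comparison with the scalar exponential series in \<open>norm A * C * norm y\<close>,
  where \<open>C\<close> is a bound of the bilinear matrix product. The variable \<open>y\<close> is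
  complex because termwise differentiation is done there.\<close>

lemma summable_matexp: "summable (\<lambda>k. (matpow A k $ i $ j / fact k) * y ^ k)"
  for A :: "complex^'n^'n"
proof -
  obtain C where C: "C > 0" "\<And>(B :: complex^'n^'n) (D :: complex^'n^'n). norm (B ** D) \<le> norm B * norm D * C"
    using bounded_bilinear.pos_bounded[OF bounded_bilinear_matrix_mult[where 'n='n]] by auto
  define M where "M = norm (mat 1 :: complex^'n^'n)"
  have bound: "norm (matpow A k) \<le> M * (norm A * C) ^ k" for k
  proof (induction k)
    case (Suc k)
    have "norm (matpow A (Suc k)) \<le> (norm A * C) * norm (matpow A k)"
      using C(2)[of A "matpow A k"] by (simp add: mult_ac)
    also have "\<dots> \<le> (norm A * C) * (M * (norm A * C) ^ k)"
      using Suc C(1) by (intro mult_left_mono) auto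
    finally show ?case by (simp add: mult_ac)
  qed (simp add: M_def)
  have "summable (\<lambda>k. M * (inverse (fact k) * (norm A * C * norm y) ^ k))"
    by (intro summable_mult summable_exp)
  then show ?thesis
  proof (rule summable_comparison_test')
    fix k
    have "norm (matpow A k $ i $ j) \<le> M * (norm A * C) ^ k"
      using bound[of k] Finite_Cartesian_Product.norm_nth_le[of "matpow A k" i]
        Finite_Cartesian_Product.norm_nth_le[of "matpow A k $ i" j] by linarith
    then have "norm (matpow A k $ i $ j) * (norm y ^ k / fact k) \<le> M * (norm A * C) ^ k * (norm y ^ k / fact k)"
      by (rule mult_right_mono) simp
    then show "norm (matpow A k $ i $ j / fact k * y ^ k) \<le> M * (inverse (fact k) * (norm A * C * norm y) ^ k)"
      by (simp add: norm_mult norm_divide norm_power power_mult_distrib divide_inverse norm_inverse mult_ac)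
  qed
qed

lemma matexp_0 [simp]: "matexp A 0 = mat 1"
proof -
  have "matexp A 0 $ i $ j = mat 1 $ i $ j" for i j
    using powser_zero[of "\<lambda>k. matpow A k $ i $ j / fact k"] by (simp add: matexp_def)
  then show ?thesis by (simp add: vec_eq_iff)
qed

lemma matexp_has_vector_derivative:
  "(matexp A has_vector_derivative (A ** matexp A t)) (at t)" for A :: "complex^'n^'n"
proof (rule has_vector_derivative_matrix)
  fix i j
  define c where "c k = matpow A k $ i $ j / fact k" for k
  have D: "((\<lambda>y. \<Sum>k. c k * y ^ k) has_field_derivative (\<Sum>k. diffs c k * y ^ k)) (at y)" for y
    unfolding c_def by (rule termdiffs_strong_converges_everywhere) (rule summable_matexp)
  \<comment> \<open>Differentiation shifts the coefficients by one; the factor k+1 cancels in the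
    factorial and one factor \<open>A\<close> comes out on the left.\<close>
  have dc: "diffs c k * y ^ k = (\<Sum>l\<in>UNIV. A $ i $ l * (matpow A k $ l $ j / fact k * y ^ k))" for k y
  proof -
    have "diffs c k = matpow A (Suc k) $ i $ j / fact k"
      unfolding diffs_def c_def by (simp del: of_nat_Suc matpow.simps)
    then show ?thesis
      by (simp add: matrix_matrix_mult_def sum_distrib_right sum_divide_distrib mult.assoc)
  qed
  have "(\<Sum>k. diffs c k * y ^ k) = (\<Sum>l\<in>UNIV. A $ i $ l * (\<Sum>k. matpow A k $ l $ j / fact k * y ^ k))" for y
    unfolding dc
    by (subst suminf_sum, (rule summable_mult summable_matexp)+) (simp only: suminf_mult[OF summable_matexp])
  then have "(\<Sum>k. diffs c k * of_real t ^ k) = (A ** matexp A t) $ i $ j"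
    by (simp add: matrix_matrix_mult_def matexp_def)
  moreover have "(\<lambda>t. matexp A t $ i $ j) = (\<lambda>y. \<Sum>k. c k * y ^ k) \<circ> of_real"
    by (simp add: matexp_def c_def fun_eq_iff)
  moreover have "((\<lambda>y. \<Sum>k. c k * y ^ k) \<circ> of_real has_vector_derivative
      (1 * (\<Sum>k. diffs c k * of_real t ^ k))) (at t)"
    by (rule field_vector_diff_chain_at[OF _ D]) (auto intro!: derivative_eq_intros)
  ultimately show "((\<lambda>t. matexp A t $ i $ j) has_vector_derivative (A ** matexp A t) $ i $ j) (at t)"
    by simp
qed

lemma constant_if_vector_derivative_0:
  fixes f :: "real \<Rightarrow> 'a::real_normed_vector"
  assumes "\<And>t. (f has_vector_derivative 0) (at t)"
  shows "f s = f t"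
proof -
  obtain c where "\<And>x. x \<in> UNIV \<Longrightarrow> f x = c"
    by (rule has_vector_derivative_zero_constant[of UNIV f]) (use assms in simp_all)
  then show ?thesis by simp
qed

lemma adjoint_matexp_has_vector_derivative:
  assumes "skew_hermitian A"
  shows "((\<lambda>t. adjoint_mat (matexp A t)) has_vector_derivative - (adjoint_mat (matexp A t) ** A)) (at t)"
  using adj_has_vector_derivative[OF matexp_has_vector_derivative, of A t] assms
  by (simp add: skew_hermitian_def adjoint_mat_mult mm.minus_right)

text \<open>The derivative is exp(tA)* (BA - AB) exp(tA) = 0, so the value at 0 persists. The case
  \<open>B = mat 1\<close> is unitarity.\<close>

lemma matexp_conj:
  assumes A: "skew_hermitian A" and AB: "A ** B = B ** A"
  shows "adjoint_mat (matexp A t) ** B ** matexp A t = B"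
proof -
  have "((\<lambda>t. adjoint_mat (matexp A t) ** B ** matexp A t) has_vector_derivative 0) (at t)" for t
  proof -
    have "((\<lambda>t. adjoint_mat (matexp A t) ** (B ** matexp A t)) has_vector_derivative
      (adjoint_mat (matexp A t) ** (B ** (A ** matexp A t)) + - (adjoint_mat (matexp A t) ** A) ** (B ** matexp A t))) (at t)"
      by (intro mm.has_vector_derivative adjoint_matexp_has_vector_derivative[OF A]
          bounded_linear.has_vector_derivative[OF mm.bounded_linear_right] matexp_has_vector_derivative)
    moreover have "adjoint_mat (matexp A t) ** (B ** (A ** matexp A t)) + - (adjoint_mat (matexp A t) ** A) ** (B ** matexp A t) = 0"
      using AB by (simp add: mm.minus_left) (metis matrix_mul_assoc)
    ultimately show ?thesis by (simp add: matrix_mul_assoc)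
  qed
  from constant_if_vector_derivative_0[OF this, of t 0] show ?thesis by simp
qed

lemma matexp_unitary: "skew_hermitian A \<Longrightarrow> matexp A t \<in> unitary_group"
  using matexp_conj[of A "mat 1" t] by (simp add: unitary_group_iff)

lemma matexp_commute:
  assumes "skew_hermitian A" "A ** B = B ** A"
  shows "matexp A t ** B = B ** matexp A t"
proof -
  have "matexp A t ** (adjoint_mat (matexp A t) ** (B ** matexp A t)) = matexp A t ** B"
    using matexp_conj[OF assms, of t] by (simp add: matrix_mul_assoc)
  then show ?thesis using unitary_cancel(4)[OF matexp_unitary[OF assms(1)]] by metis
qed

lemma matexp_add:
  assumes A: "skew_hermitian A"
  shows "matexp A (t + s) = matexp A t ** matexp A s"
proof -
  have "((\<lambda>t. adjoint_mat (matexp A t) ** matexp A (t + s)) has_vector_derivative 0) (at t)" for t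
  proof -
    have "((\<lambda>t. t + s) has_vector_derivative 1) (at t)"
      by (auto intro!: derivative_eq_intros)
    from vector_diff_chain_at[OF this matexp_has_vector_derivative, of A]
    have "((\<lambda>t. matexp A (t + s)) has_vector_derivative A ** matexp A (t + s)) (at t)"
      by (simp add: o_def)
    from mm.has_vector_derivative[OF adjoint_matexp_has_vector_derivative[OF A] this]
    show ?thesis by (simp add: matrix_mul_assoc mm.minus_left)
  qed
  from constant_if_vector_derivative_0[OF this, of t 0]
  have "adjoint_mat (matexp A t) ** matexp A (t + s) = matexp A s" by simp
  then show ?thesis using unitary_cancel(4)[OF matexp_unitary[OF A]] by metis
qed

text \<open>A nontrivial permutation moves at least two points, \<open>a\<close> and
  \<open>p a\<close>; one of them survives the removal of \<open>i\<close> and contributes an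
  off-diagonal zero.\<close>

lemma prod_mat_1_eq_0:
  fixes p :: "'n::finite \<Rightarrow> 'n"
  assumes p: "p permutes UNIV" "p \<noteq> id"
  shows "(\<Prod>j\<in>UNIV - {i}. (mat 1 :: complex^'n^'n) $ j $ p j) = 0"
proof -
  obtain a where a: "p a \<noteq> a" using p(2) by (auto simp: fun_eq_iff)
  moreover have "p (p a) \<noteq> p a" using a permutes_inj[OF p(1)] by (metis injD)
  ultimately obtain k where "k \<noteq> i" "p k \<noteq> k" by metis
  then show ?thesis
    by (intro prod_zero) (auto simp: mat_def intro!: bexI[of _ k])
qed

text \<open>Jacobi's formula at the identity: in the differentiated Leibniz expansion only the
  identity permutation survives.\<close>

lemma det_has_vector_derivative_at_one:
  fixes M :: "real \<Rightarrow> complex^'n^'n"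
  assumes M: "(M has_vector_derivative A) (at 0)" and M0: "M 0 = mat 1"
  shows "((\<lambda>t. det (M t)) has_vector_derivative trace A) (at 0)"
proof -
  have entry: "((\<lambda>t. M t $ i $ j) has_derivative (\<lambda>h. h *\<^sub>R A $ i $ j)) (at 0)" for i j
    using bounded_linear.has_derivative[OF bounded_linear_vec_nth
        bounded_linear.has_derivative[OF bounded_linear_vec_nth M[unfolded has_vector_derivative_def]]]
    by simp
  have D: "((\<lambda>t. det (M t)) has_derivative
    (\<lambda>h. \<Sum>p | p permutes UNIV. of_int (sign p) * (\<Sum>i\<in>UNIV. h *\<^sub>R A $ i $ p i * (\<Prod>j\<in>UNIV - {i}. M 0 $ j $ p j)))) (at 0)"
    unfolding det_def
    by (intro has_derivative_sum has_derivative_mult_right has_derivative_prod entry)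
  have "(\<Sum>p | p permutes UNIV. of_int (sign p) * (\<Sum>i\<in>UNIV. h *\<^sub>R A $ i $ p i * (\<Prod>j\<in>UNIV - {i}. M 0 $ j $ p j)))
      = h *\<^sub>R trace A" for h
  proof -
    have "(\<Sum>p | p permutes (UNIV::'n set). of_int (sign p) * (\<Sum>i\<in>UNIV. h *\<^sub>R A $ i $ p i * (\<Prod>j\<in>UNIV - {i}. M 0 $ j $ p j)))
      = (\<Sum>p\<in>{id}. of_int (sign p) * (\<Sum>i\<in>UNIV. h *\<^sub>R A $ i $ p i * (\<Prod>j\<in>UNIV - {i}. M 0 $ j $ p j)))"
      by (rule sum.mono_neutral_right) (auto simp: M0 prod_mat_1_eq_0 permutes_id finite_permutations)
    also have "\<dots> = h *\<^sub>R trace A"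
      by (simp add: M0 mat_def trace_def scaleR_sum_right)
    finally show ?thesis .
  qed
  then show ?thesis using D by (simp add: has_vector_derivative_def)
qed

lemma det_matexp:
  fixes A :: "complex^'n^'n"
  assumes A: "skew_hermitian A" and tr: "trace A = 0"
  shows "det (matexp A t) = 1"
proof -
  \<comment> \<open>The group law gives det exp(sA) = det exp((s-t)A) * det exp(tA), so the
    derivative at 0, which is the trace, decides the derivative at every \<open>t\<close>.\<close>
  have "((\<lambda>t. det (matexp A t)) has_vector_derivative 0) (at t)" for t
  proof -
    have "((\<lambda>h. det (matexp A h)) has_vector_derivative 0) (at (t + (- t)))"
      using det_has_vector_derivative_at_one[of "matexp A" A] matexp_has_vector_derivative[of A 0] tr
      by simp
    moreover have "((\<lambda>s. s + (- t)) has_vector_derivative 1) (at t)"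
      by (auto intro!: derivative_eq_intros)
    ultimately have "((\<lambda>s. det (matexp A (s + (- t)))) has_vector_derivative 0) (at t)"
      using vector_diff_chain_at[of "\<lambda>s. s + (- t)" 1 t "\<lambda>h. det (matexp A h)" 0] by (simp add: o_def)
    from has_vector_derivative_mult_left[OF this, of "det (matexp A t)"]
    have "((\<lambda>s. det (matexp A (s + (- t))) * det (matexp A t)) has_vector_derivative 0) (at t)" by simp
    then show ?thesis
      by (simp add: det_mul[symmetric] matexp_add[OF A, symmetric])
  qed
  from constant_if_vector_derivative_0[OF this, of t 0] show ?thesis by simp
qed

lemma matexp_special_unitary:
  "skew_hermitian A \<Longrightarrow> trace A = 0 \<Longrightarrow> matexp A t \<in> special_unitary_group"
  by (simp add: special_unitary_group_def matexp_unitary det_matexp)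

section \<open>Caratheodory solutions\<close>

text \<open>Only \<open>f (u s) (q s)\<close> is known to be integrable, not the coefficients \<open>f (u s)\<close>, so no propagator is available.
  Instead the distance to \<open>C\<close> is summed over a fine tagged division: on each interval the flow with the control frozen
  at the tag does not increase it, and Henstock's lemma bounds the total error.\<close>

lemma solution_stays_in_closed_invariant_set:
  fixes f :: "'u::euclidean_space \<Rightarrow> 'x::euclidean_space \<Rightarrow> 'x" and \<Phi> :: "'u \<Rightarrow> real \<Rightarrow> 'x \<Rightarrow> 'x"
  assumes sol: "is_solution f M T u q0 q" and T: "0 \<le> T" and u: "\<And>t. t \<in> {0..T} \<Longrightarrow> u t \<in> U"
    and C: "closed C" "q0 \<in> C"
    and inv: "\<And>w h x. w \<in> U \<Longrightarrow> 0 \<le> h \<Longrightarrow> x \<in> C \<Longrightarrow> \<Phi> w h x \<in> C"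
    and iso: "\<And>w h x y. w \<in> U \<Longrightarrow> 0 \<le> h \<Longrightarrow> dist (\<Phi> w h x) (\<Phi> w h y) \<le> dist x y"
    and lin: "\<And>w. w \<in> U \<Longrightarrow> bounded_linear (f w)"
    and der: "\<And>w e. w \<in> U \<Longrightarrow> 0 < e \<Longrightarrow>
      \<exists>d>0. \<forall>h x. 0 \<le> h \<and> h < d \<longrightarrow> norm (\<Phi> w h x - x - h *\<^sub>R f w x) \<le> e * h * norm x"
  shows "q T \<in> C"
proof -
  define F where "F = (\<lambda>s. f (u s) (q s))"
  have qint: "(F has_integral (q t - q0)) {0..t}" if "t \<in> {0..T}" for t
    using sol that by (simp add: is_solution_def F_def)
  have Fint: "F integrable_on {0..T}" using qint[of T] T by (auto simp: has_integral_integrable)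
  have q_eq: "q t = q0 + integral {0..t} F" if "t \<in> {0..T}" for t
    using integral_unique[OF qint[OF that]] by simp
  have qcont: "continuous_on {0..T} q"
    by (subst continuous_on_cong[OF refl q_eq])
      (auto intro!: continuous_intros indefinite_integral_continuous_1 Fint)
  obtain B where B: "B > 0" "\<And>t. t \<in> {0..T} \<Longrightarrow> norm (q t) \<le> B"
    using compact_imp_bounded[OF compact_continuous_image[OF qcont compact_Icc]]
    unfolding bounded_pos by auto
  have main: "infdist (q T) C \<le> e * (1 + 2 * T)" if e: "e > 0" for e
  proof -
    have "\<exists>r>0. x \<in> {0..T} \<longrightarrow>
      (\<forall>s\<in>{0..T}. dist x s < r \<longrightarrow> norm (f (u x) (q x) - f (u x) (q s)) \<le> e) \<and>
      (\<forall>h y. 0 \<le> h \<and> h < 2 * r \<longrightarrow> norm (\<Phi> (u x) h y - y - h *\<^sub>R f (u x) y) \<le> e / B * h * norm y)" for x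
    proof (cases "x \<in> {0..T}")
      case True
      have "continuous_on {0..T} (\<lambda>s. f (u x) (q s))"
        using bounded_linear.continuous_on[OF lin[OF u[OF True]] qcont] .
      then obtain r1 where r1: "r1 > 0"
        "\<And>s. s \<in> {0..T} \<Longrightarrow> dist s x < r1 \<Longrightarrow> dist (f (u x) (q s)) (f (u x) (q x)) < e"
        using True e unfolding continuous_on_iff by meson
      obtain r2 where r2: "r2 > 0" "\<forall>h y. 0 \<le> h \<and> h < r2 \<longrightarrow>
          norm (\<Phi> (u x) h y - y - h *\<^sub>R f (u x) y) \<le> e / B * h * norm y"
        using der[OF u[OF True], of "e / B"] e B by auto
      show ?thesis
      proof (intro exI[of _ "min r1 (r2 / 2)"] conjI impI ballI)
        fix s assume "s \<in> {0..T}" "dist x s < min r1 (r2 / 2)"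
        then have "dist (f (u x) (q s)) (f (u x) (q x)) < e" using r1(2) by (simp add: dist_commute)
        then show "norm (f (u x) (q x) - f (u x) (q s)) \<le> e"
          by (simp add: dist_norm norm_minus_commute)
      qed (use r1 r2 in auto)
    qed (auto intro: exI[of _ 1])
    then obtain r where r: "\<And>x. r x > 0"
      and r1: "\<And>x s. x \<in> {0..T} \<Longrightarrow> s \<in> {0..T} \<Longrightarrow> dist x s < r x \<Longrightarrow> norm (f (u x) (q x) - f (u x) (q s)) \<le> e"
      and r2: "\<And>x h y. x \<in> {0..T} \<Longrightarrow> 0 \<le> h \<Longrightarrow> h < 2 * r x \<Longrightarrow>
          norm (\<Phi> (u x) h y - y - h *\<^sub>R f (u x) y) \<le> e / B * h * norm y"
      by metis
    obtain \<gamma> where \<gamma>: "gauge \<gamma>"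
      "\<And>p. p tagged_partial_division_of (cbox 0 T) \<Longrightarrow> \<gamma> fine p \<Longrightarrow>
          (\<Sum>(x,k)\<in>p. norm (measure lborel k *\<^sub>R F x - integral k F)) < e"
      by (rule Henstock_lemma[of F 0 T e]) (use Fint e in auto)
    have "gauge (\<lambda>x. \<gamma> x \<inter> ball x (r x))"
      using \<gamma>(1) r by (intro gauge_Int gauge_ball_dependent) auto
    then obtain p where p: "p tagged_division_of {0..T}" "(\<lambda>x. \<gamma> x \<inter> ball x (r x)) fine p"
      using fine_division_exists_real by blast
    have fine: "\<gamma> fine p" "(\<lambda>x. ball x (r x)) fine p"
      using p(2) by (simp_all add: fine_Int)
    have step: "infdist (q (Sup k)) C - infdist (q (Inf k)) C
        \<le> norm (measure lborel k *\<^sub>R F x - integral k F) + 2 * e * measure lborel k" if xk: "(x, k) \<in> p" for x k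
    proof -
      obtain a b where "k = cbox a b" using tagged_division_ofD(4)[OF p(1) xk] by blast
      moreover have x: "x \<in> k" "k \<subseteq> {0..T}" using tagged_division_ofD(2,3)[OF p(1) xk] by auto
      ultimately have k: "k = {a..b}" "a \<le> b" and ab: "a \<in> {0..T}" "b \<in> {0..T}" and xT: "x \<in> {0..T}"
        by auto
      have kb: "k \<subseteq> ball x (r x)" using fine(2) xk by (auto simp: fine_def)
      have "a \<in> k" "b \<in> k" using k by auto
      then have ar: "dist x a < r x" and br: "dist x b < r x" using kb by auto
      define h where "h = b - a"
      have h: "0 \<le> h" "h < 2 * r x" using ar br k by (auto simp: h_def dist_real_def)
      have cont: "measure lborel k = h" using k by (simp add: h_def)
      have wU: "u x \<in> U" using u[OF xT] .
      have "integral {0..a} F + integral {a..b} F = integral {0..b} F"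
        using ab k Fint by (intro Henstock_Kurzweil_Integration.integral_combine)
          (auto intro: integrable_subinterval_real)
      then have ik: "integral k F = q b - q a" using q_eq[OF ab(1)] q_eq[OF ab(2)] k
        by (simp add: eq_diff_eq add.commute)
      define z where "z = \<Phi> (u x) h (q a)"
      have zC: "infdist z C \<le> infdist (q a) C"
      proof -
        obtain y where "y \<in> C" "infdist (q a) C = dist (q a) y"
          using infdist_attains_inf[of C "q a"] C by blast
        then show ?thesis
          using infdist_le[OF inv[OF wU h(1)], of y z] iso[OF wU h(1), of "q a" y] by (simp add: z_def)
      qed
      have "q b - z = - (measure lborel k *\<^sub>R F x - integral k F) + h *\<^sub>R (f (u x) (q x) - f (u x) (q a))
          - (z - q a - h *\<^sub>R f (u x) (q a))"
        by (simp add: ik cont fun_cong[OF F_def, of x] algebra_simps)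
      then have "norm (q b - z) \<le> norm (measure lborel k *\<^sub>R F x - integral k F)
          + norm (h *\<^sub>R (f (u x) (q x) - f (u x) (q a))) + norm (z - q a - h *\<^sub>R f (u x) (q a))"
        by (smt (verit) norm_minus_cancel norm_triangle_ineq norm_triangle_ineq4)
      also have "norm (h *\<^sub>R (f (u x) (q x) - f (u x) (q a))) \<le> e * h"
        using mult_left_mono[OF r1[OF xT ab(1) ar] h(1)] h by (simp add: mult.commute)
      also have "norm (z - q a - h *\<^sub>R f (u x) (q a)) \<le> e * h"
      proof -
        have "norm (z - q a - h *\<^sub>R f (u x) (q a)) \<le> e / B * h * norm (q a)"
          using r2[OF xT h] by (simp add: z_def)
        also have "\<dots> \<le> e / B * h * B"
          using B ab(1) e h by (intro mult_left_mono) auto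
        finally show ?thesis using B by simp
      qed
      finally have "norm (q b - z) \<le> norm (measure lborel k *\<^sub>R F x - integral k F) + 2 * e * measure lborel k"
        by (simp add: cont)
      moreover have "infdist (q b) C \<le> infdist z C + norm (q b - z)"
        using infdist_triangle[of "q b" C z] by (simp add: dist_norm)
      ultimately show ?thesis using zC k by simp
    qed
    have "infdist (q T) C - infdist (q 0) C = (\<Sum>(x,k)\<in>p. infdist (q (Sup k)) C - infdist (q (Inf k)) C)"
      using additive_tagged_division_1[OF T p(1), of "\<lambda>t. infdist (q t) C"] by simp
    also have "\<dots> \<le> (\<Sum>(x,k)\<in>p. norm (measure lborel k *\<^sub>R F x - integral k F) + 2 * e * measure lborel k)"
      using step by (intro sum_mono) auto
    also have "\<dots> = (\<Sum>(x,k)\<in>p. norm (measure lborel k *\<^sub>R F x - integral k F)) + 2 * e * (\<Sum>(x,k)\<in>p. measure lborel k)"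
      by (simp add: sum.distrib case_prod_unfold sum_distrib_left)
    also have "(\<Sum>(x,k)\<in>p. measure lborel k) = T"
      using additive_content_tagged_division[of p 0 T] p(1) T by simp
    also have "(\<Sum>(x,k)\<in>p. norm (measure lborel k *\<^sub>R F x - integral k F)) \<le> e"
      using \<gamma>(2)[of p] p(1) fine(1) by (simp add: tagged_division_of_def less_imp_le)
    finally have "infdist (q T) C - infdist (q 0) C \<le> e + 2 * e * T" by simp
    moreover have "infdist (q 0) C = 0" using sol C by (simp add: is_solution_def)
    ultimately show ?thesis by (simp add: algebra_simps)
  qed
  have "infdist (q T) C \<le> 0"
  proof (rule field_le_epsilon)
    fix e :: real assume "e > 0"
    then show "infdist (q T) C \<le> 0 + e"
      using main[of "e / (1 + 2 * T)"] T by simp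
  qed
  then have "infdist (q T) C = 0" using infdist_nonneg[of "q T" C] by linarith
  then show ?thesis using in_closed_iff_infdist_zero[of C] C by blast
qed

text \<open>Concatenation with a constant control: the hypotheses on \<open>c\<close> are those of a
  classical integral curve, which the fundamental theorem of calculus turns into a Caratheodory
  solution.\<close>

lemma reachable_set_append:
  fixes f :: "'u::euclidean_space \<Rightarrow> 'x::euclidean_space \<Rightarrow> 'x"
  assumes p: "p \<in> reachable_set f M U q0" and w: "w \<in> U" and t: "0 \<le> t"
    and c0: "c 0 = p" and der: "\<And>s. (c has_vector_derivative f w (c s)) (at s)"
    and cont: "continuous_on UNIV (\<lambda>s. f w (c s))" and cM: "\<And>s. 0 \<le> s \<Longrightarrow> c s \<in> M"
  shows "c t \<in> reachable_set f M U q0"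
proof -
  obtain T u q where T: "0 \<le> T" and adm: "admissible_control U T u"
    and sol: "is_solution f M T u q0 q" and pq: "p = q T"
    using p by (auto simp: reachable_set_def)
  define u' where "u' s = (if s \<in> {..T} then u s else w)" for s
  define q' where "q' s = (if s \<le> T then q s else c (s - T))" for s
  have q'T: "q' (T + t) = c t" using pq c0 by (cases "t = 0") (use t in \<open>auto simp: q'_def\<close>)
  have "admissible_control U (T + t) u'"
    unfolding admissible_control_def
  proof (intro conjI ballI)
    \<comment> \<open>The control is known to be measurable on \<open>{0..T}\<close> only; cutting
      it off by 0 gives a measurable function on the whole line. That 0 need not lie in
      \<open>U\<close> does no harm, since \<open>u'\<close> agrees with the glued function on the
      interval that matters.\<close>
    define u0 where "u0 s = (if s \<in> {0..T} then u s else 0)" for s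
    have "u0 \<in> borel_measurable lebesgue"
      unfolding u0_def using adm by (subst borel_measurable_if) (auto simp: admissible_control_def)
    then have "(\<lambda>s. if s \<in> {..T} then u0 s else w) \<in> borel_measurable lebesgue"
      by (intro measurable_If_set) auto
    then have "(\<lambda>s. if s \<in> {..T} then u0 s else w) \<in> borel_measurable (lebesgue_on {0..T + t})"
      by (rule measurable_restrict_space1)
    then show "u' \<in> borel_measurable (lebesgue_on {0..T + t})"
      by (rule measurable_cong[THEN iffD1, rotated]) (auto simp: u'_def u0_def)
    obtain B where "AE s in lebesgue_on {0..T}. norm (u s) \<le> B"
      using adm by (auto simp: admissible_control_def)
    then have "AE s in lebesgue. s \<in> {0..T} \<longrightarrow> norm (u s) \<le> B"
      by (subst (asm) AE_restrict_space_iff) auto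
    then have "AE s in lebesgue. s \<in> {0..T + t} \<longrightarrow> norm (u' s) \<le> max B (norm w)"
      by eventually_elim (auto simp: u'_def)
    then have "AE s in lebesgue_on {0..T + t}. norm (u' s) \<le> max B (norm w)"
      by (subst AE_restrict_space_iff) auto
    then show "\<exists>B. AE s in lebesgue_on {0..T + t}. norm (u' s) \<le> B" ..
    show "u' s \<in> U" if "s \<in> {0..T + t}" for s
      using that adm w by (auto simp: u'_def admissible_control_def)
  qed
  moreover have "is_solution f M (T + t) u' q0 q'"
    unfolding is_solution_def
  proof (intro conjI ballI)
    show "q' 0 = q0" using sol T by (simp add: q'_def is_solution_def)
    show "q' s \<in> M" if "s \<in> {0..T + t}" for s
      using that sol cM by (auto simp: q'_def is_solution_def)
    have old: "f (u' s) (q' s) = f (u s) (q s)" if "s \<le> T" for s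
      using that by (simp add: u'_def q'_def)
    have new: "f (u' s) (q' s) = f w (c (s - T))" if "s \<in> {T..b} - {T}" for s b
      using that by (simp add: u'_def q'_def)
    have "(\<lambda>s. f (u s) (q s)) absolutely_integrable_on {0..T}"
      using sol by (simp add: is_solution_def)
    then have "(\<lambda>s. f (u' s) (q' s)) absolutely_integrable_on {0..T}"
      by (rule absolutely_integrable_spike[where S="{}"]) (auto simp: old)
    moreover have "(\<lambda>s. f (u' s) (q' s)) absolutely_integrable_on {T..T + t}"
    proof (rule absolutely_integrable_spike[where f="\<lambda>s. f w (c (s - T))" and S="{T}"])
      have "continuous_on UNIV (\<lambda>s. f w (c (s - T)))"
        by (rule continuous_on_compose2[OF cont]) (auto intro!: continuous_intros)
      then show "(\<lambda>s. f w (c (s - T))) absolutely_integrable_on {T..T + t}"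
        by (intro absolutely_integrable_continuous_real) (auto intro: continuous_on_subset)
    qed (use new in auto)
    ultimately show "(\<lambda>s. f (u' s) (q' s)) absolutely_integrable_on {0..T + t}"
      by (rule absolutely_integrable_on_combine) (use T t in auto)
    fix b assume b: "b \<in> {0..T + t}"
    have old_int: "((\<lambda>s. f (u' s) (q' s)) has_integral (q b - q0)) {0..b}" if "b \<in> {0..T}" for b
    proof (rule has_integral_eq)
      show "((\<lambda>s. f (u s) (q s)) has_integral (q b - q0)) {0..b}"
        using sol that by (simp add: is_solution_def)
    qed (use that old in auto)
    show "((\<lambda>s. f (u' s) (q' s)) has_integral (q' b - q0)) {0..b}"
    proof (cases "b \<le> T")
      case True
      then show ?thesis using old_int[of b] b by (simp add: q'_def)
    next
      case False
      have "((\<lambda>s. f w (c (s - T))) has_integral (c (b - T) - c (T - T))) {T..b}"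
      proof (rule fundamental_theorem_of_calculus)
        fix s
        have "((\<lambda>s. s - T) has_vector_derivative 1) (at s)" by (auto intro!: derivative_eq_intros)
        from vector_diff_chain_at[OF this der]
        have "((\<lambda>s. c (s - T)) has_vector_derivative f w (c (s - T))) (at s)" by (simp add: o_def)
        then show "((\<lambda>s. c (s - T)) has_vector_derivative f w (c (s - T))) (at s within {T..b})"
          by (rule has_vector_derivative_at_within)
      qed (use False in simp)
      then have "((\<lambda>s. f (u' s) (q' s)) has_integral (c (b - T) - c (T - T))) {T..b}"
        by (rule has_integral_spike_finite[where S="{T}", rotated 2]) (use new in auto)
      from has_integral_combine[OF T _ old_int this] False T
      show ?thesis by (simp add: q'_def c0 pq)
    qed
  qed
  ultimately show ?thesis
    unfolding reachable_set_def using T t q'T by (intro CollectI exI[of _ "T + t"] exI[of _ u'] exI[of _ q']) auto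
qed

section \<open>Semigroup and Lie algebra of a skew-Hermitian system\<close>

text \<open>Right-hand difference quotients lie in \<open>V\<close>, and finite-dimensional
  subspaces are closed. Nonnegative times suffice, which matters because only forward flows are
  known to lie in \<open>S\<close>.\<close>

lemma derivative_mem_subspace:
  fixes f :: "real \<Rightarrow> 'a::euclidean_space"
  assumes V: "subspace V" and f: "(f has_vector_derivative D) (at 0)" and mem: "\<And>t. 0 \<le> t \<Longrightarrow> f t \<in> V"
  shows "D \<in> V"
proof -
  have "(f has_vector_derivative D) (at 0 within {0<..})"
    using f by (rule has_vector_derivative_at_within)
  then have "((\<lambda>t. (1 / norm (t - 0)) *\<^sub>R (f t - (f 0 + (t - 0) *\<^sub>R D))) \<longlongrightarrow> 0) (at_right 0)"
    unfolding has_vector_derivative_def has_derivative_within by blast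
  then have "((\<lambda>t. (1 / t) *\<^sub>R (f t - f 0) - D) \<longlongrightarrow> 0) (at_right 0)"
    by (rule Lim_transform_eventually)
      (auto simp: eventually_at_filter algebra_simps)
  then have "((\<lambda>t. (1 / t) *\<^sub>R (f t - f 0)) \<longlongrightarrow> D) (at_right 0)"
    by (simp add: LIM_zero_iff)
  moreover have "\<forall>\<^sub>F t in at_right 0. (1 / t) *\<^sub>R (f t - f 0) \<in> V"
    by (rule eventually_mono[OF eventually_at_right_less])
      (auto intro!: V subspace_scale subspace_diff mem)
  ultimately show ?thesis
    by (intro Lim_in_closed_set[OF closed_subspace[OF V]]) auto
qed

locale skew_system =
  fixes X :: "'u \<Rightarrow> complex^'n^'n" and U :: "'u set"
  assumes skew: "u \<in> U \<Longrightarrow> skew_hermitian (X u)"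
begin

inductive_set S where
  one: "mat 1 \<in> S"
| step: "g \<in> S \<Longrightarrow> u \<in> U \<Longrightarrow> 0 < t \<Longrightarrow> matexp (X u) t ** g \<in> S"

text \<open>Conjugates under \<open>S\<close> take the place of iterated brackets: they are the
  velocities that products of forward flows produce, and invariance under conjugation is nearly
  built in. Closure under brackets is recovered by differentiation.\<close>

definition W where "W = span {adjoint_mat h ** X u ** h |h u. h \<in> S \<and> u \<in> U}"

lemma S_unitary: "g \<in> S \<Longrightarrow> g \<in> unitary_group"
  by (induction rule: S.induct) (auto intro: unitary_mult matexp_unitary skew)

lemma S_mult: "g \<in> S \<Longrightarrow> h \<in> S \<Longrightarrow> g ** h \<in> S"
  by (induction rule: S.induct) (auto intro: S.step simp flip: matrix_mul_assoc)

lemma matexp_in_S: "u \<in> U \<Longrightarrow> 0 \<le> t \<Longrightarrow> matexp (X u) t \<in> S"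
  using S.one S.step[OF S.one, of u t] by (cases "t = 0") auto

lemma subspace_W: "subspace W"
  by (simp add: W_def)

lemma conj_X_in_W: "h \<in> S \<Longrightarrow> u \<in> U \<Longrightarrow> adjoint_mat h ** X u ** h \<in> W"
  unfolding W_def by (rule span_base) blast

lemma X_in_W: "u \<in> U \<Longrightarrow> X u \<in> W"
  using conj_X_in_W[OF S.one] by simp

lemma W_induct [consumes 1, case_names subspace generator]:
  assumes "A \<in> W" "subspace {A. P A}" "\<And>h u. h \<in> S \<Longrightarrow> u \<in> U \<Longrightarrow> P (adjoint_mat h ** X u ** h)"
  shows "P A"
proof -
  have "W \<subseteq> {A. P A}"
    unfolding W_def by (rule span_minimal) (use assms in auto)
  then show ?thesis using assms(1) by blast
qed

lemma W_skew: "A \<in> W \<Longrightarrow> skew_hermitian A"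
proof (induction rule: W_induct)
  case subspace
  show ?case by (auto simp: subspace_def skew_hermitian_def adj_add adj_scaleR adj_zero)
next
  case (generator h u)
  then show ?case using skew[of u]
    by (simp add: skew_hermitian_def adjoint_mat_mult matrix_mul_assoc mm.minus_left mm.minus_right)
qed

lemma conj_W:
  assumes "h \<in> S" "A \<in> W"
  shows "adjoint_mat h ** A ** h \<in> W"
  using assms(2)
proof (induction rule: W_induct)
  case subspace
  show ?case using subspace_W
    by (auto simp: subspace_def mm.add_left mm.add_right mm.scaleR_left mm.scaleR_right)
next
  case (generator k u)
  then show ?case using conj_X_in_W[OF S_mult[OF _ assms(1)], of k u]
    by (simp add: adjoint_mat_mult matrix_mul_assoc)
qed

text \<open>Conjugation is injective and linear, so mapping the finite-dimensional \<open>W\<close>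
  into itself it is onto. This supplies conjugation by inverses, although \<open>S\<close> need not
  contain them.\<close>

lemma conj_W_image:
  assumes h: "h \<in> S"
  shows "(\<lambda>A. adjoint_mat h ** A ** h) ` W = W"
proof (rule subspace_dim_equal)
  have lin: "linear (\<lambda>A. adjoint_mat h ** A ** h)"
    by (auto intro!: linearI simp: mm.add_left mm.add_right mm.scaleR_left mm.scaleR_right)
  have "h ** (adjoint_mat h ** A ** h) ** adjoint_mat h = A" for A
    using unitary_cancel[OF S_unitary[OF h]] by (simp flip: matrix_mul_assoc)
  then have "inj_on (\<lambda>A. adjoint_mat h ** A ** h) (span W)"
    by (intro inj_on_inverseI[where g="\<lambda>B. h ** B ** adjoint_mat h"])
  then show "dim W \<le> dim ((\<lambda>A. adjoint_mat h ** A ** h) ` W)"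
    by (simp add: dim_image_eq[OF lin])
  show "subspace ((\<lambda>A. adjoint_mat h ** A ** h) ` W)"
    by (rule linear_subspace_image[OF lin subspace_W])
qed (use conj_W[OF h] subspace_W in auto)

lemma conj_W':
  assumes "h \<in> S" "A \<in> W"
  shows "h ** A ** adjoint_mat h \<in> W"
proof -
  obtain B where "B \<in> W" "A = adjoint_mat h ** B ** h" using conj_W_image[OF assms(1)] assms(2) by blast
  then show ?thesis
    using unitary_cancel[OF S_unitary[OF assms(1)]] by (simp flip: matrix_mul_assoc)
qed

text \<open>The commutant condition is what makes Schur's lemma available: an element of the normalizer of \<open>W\<close> need not
  commute with the commutant of \<open>W\<close>.\<close>

definition K where
  "K = {g \<in> unitary_group. (\<forall>A\<in>W. adjoint_mat g ** A ** g \<in> W) \<and> (\<forall>A\<in>W. g ** A ** adjoint_mat g \<in> W)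
     \<and> (\<forall>Y. (\<forall>A\<in>W. Y ** A = A ** Y) \<longrightarrow> Y ** g = g ** Y)}"

lemma K_unitary: "g \<in> K \<Longrightarrow> g \<in> unitary_group"
  by (simp add: K_def)

lemma K_conj: "g \<in> K \<Longrightarrow> A \<in> W \<Longrightarrow> adjoint_mat g ** A ** g \<in> W"
  "g \<in> K \<Longrightarrow> A \<in> W \<Longrightarrow> g ** A ** adjoint_mat g \<in> W"
  by (simp_all add: K_def)

lemma K_commute: "g \<in> K \<Longrightarrow> (\<And>A. A \<in> W \<Longrightarrow> Y ** A = A ** Y) \<Longrightarrow> Y ** g = g ** Y"
  by (simp add: K_def)

lemma K_mult:
  assumes "g \<in> K" "h \<in> K"
  shows "g ** h \<in> K"
  unfolding K_def
proof (intro CollectI conjI ballI allI impI)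
  show "g ** h \<in> unitary_group" using assms by (simp add: K_unitary unitary_mult)
  fix A assume A: "A \<in> W"
  show "adjoint_mat (g ** h) ** A ** (g ** h) \<in> W"
    using K_conj(1)[OF assms(2) K_conj(1)[OF assms(1) A]] by (simp add: adjoint_mat_mult matrix_mul_assoc)
  show "g ** h ** A ** adjoint_mat (g ** h) \<in> W"
    using K_conj(2)[OF assms(1) K_conj(2)[OF assms(2) A]] by (simp add: adjoint_mat_mult matrix_mul_assoc)
next
  fix Y assume "\<forall>A\<in>W. Y ** A = A ** Y"
  then have "Y ** g = g ** Y" "Y ** h = h ** Y" using K_commute assms by auto
  then show "Y ** (g ** h) = g ** h ** Y" by (metis matrix_mul_assoc)
qed

lemma K_adjoint_mat:
  assumes "g \<in> K"
  shows "adjoint_mat g \<in> K"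
  unfolding K_def
proof (intro CollectI conjI ballI allI impI)
  show "adjoint_mat g \<in> unitary_group" using assms by (simp add: K_unitary unitary_adjoint_mat)
next
  fix Y assume "\<forall>A\<in>W. Y ** A = A ** Y"
  then have "Y ** g = g ** Y" using K_commute assms by auto
  then have "adjoint_mat g ** (Y ** g) ** adjoint_mat g = adjoint_mat g ** (g ** Y) ** adjoint_mat g" by simp
  then show "Y ** adjoint_mat g = adjoint_mat g ** Y"
    using unitary_cancel[OF K_unitary[OF assms]] by (simp flip: matrix_mul_assoc)
qed (use assms K_conj in auto)

lemma S_subset_K: "S \<subseteq> K"
proof
  fix g assume g: "g \<in> S"
  have "Y ** g = g ** Y" if "\<forall>A\<in>W. Y ** A = A ** Y" for Y
    using g
  proof (induction rule: S.induct)
    case (step g u t)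
    then have "Y ** matexp (X u) t = matexp (X u) t ** Y"
      using that X_in_W by (metis matexp_commute skew)
    then show ?case using step by (metis matrix_mul_assoc)
  qed simp
  then show "g \<in> K"
    using g S_unitary conj_W conj_W' by (auto simp: K_def)
qed

lemma closed_K: "closed K"
proof -
  have "K = unitary_group \<inter> (\<Inter>A\<in>W. (\<lambda>g. adjoint_mat g ** A ** g) -` W) \<inter> (\<Inter>A\<in>W. (\<lambda>g. g ** A ** adjoint_mat g) -` W)
      \<inter> (\<Inter>Y\<in>{Y. \<forall>A\<in>W. Y ** A = A ** Y}. {g. Y ** g = g ** Y})"
    by (auto simp: K_def)
  also have "closed \<dots>"
    using closed_subspace[OF subspace_W]
    by (intro closed_Int closed_unitary_group closed_INT ballI closed_vimage closed_Collect_eq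
        mm.continuous_on adj_continuous_on continuous_intros)
  finally show ?thesis .
qed

lemma compact_K: "compact K"
  using closed_K bounded_subset[OF bounded_unitary_group, of K] K_unitary
  by (auto simp: compact_eq_bounded_closed)

lemma matexp_in_K: "u \<in> U \<Longrightarrow> 0 \<le> t \<Longrightarrow> matexp (X u) t \<in> K"
  using matexp_in_S S_subset_K by blast

section \<open>The span is closed under brackets\<close>

lemma matexp_conj_has_vector_derivative:
  assumes Z: "skew_hermitian Z"
  shows "((\<lambda>t. matexp Z t ** A ** adjoint_mat (matexp Z t)) has_vector_derivative
     lie_bracket Z (matexp Z t ** A ** adjoint_mat (matexp Z t))) (at t)"
proof -
  have "((\<lambda>t. matexp Z t ** (A ** adjoint_mat (matexp Z t))) has_vector_derivative
      (matexp Z t ** (A ** - (adjoint_mat (matexp Z t) ** Z)) + (Z ** matexp Z t) ** (A ** adjoint_mat (matexp Z t)))) (at t)"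
    by (intro mm.has_vector_derivative adjoint_matexp_has_vector_derivative[OF Z]
        bounded_linear.has_vector_derivative[OF mm.bounded_linear_right] matexp_has_vector_derivative)
  then show ?thesis
    by (simp add: lie_bracket_def mm.minus_right matrix_mul_assoc)
qed

text \<open>The bracket is the derivative at 0 of conjugation by \<open>matexp Z t\<close>, a curve
  that stays in \<open>W\<close> for nonnegative times.\<close>

lemma bracket_mem_W:
  assumes Z: "skew_hermitian Z" and E: "\<And>t. 0 \<le> t \<Longrightarrow> matexp Z t \<in> K" and A: "A \<in> W"
  shows "lie_bracket Z A \<in> W"
  using derivative_mem_subspace[OF subspace_W matexp_conj_has_vector_derivative[OF Z, of A 0]]
    K_conj(2)[OF E A] by simp

text \<open>For a generator, [h* X h, B] = h* [X, h B h*] h, which reduces the claim to bracketing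
  with a single \<open>X u\<close>, whose flow lies in \<open>K\<close>.\<close>

lemma bracket_W:
  assumes "A \<in> W" "B \<in> W"
  shows "lie_bracket A B \<in> W"
  using assms(1)
proof (induction rule: W_induct)
  case subspace
  show ?case using subspace_W
    by (auto simp: subspace_def lie_bracket_simps)
next
  case (generator h u)
  define B' where "B' = h ** B ** adjoint_mat h"
  have "B' \<in> W" unfolding B'_def using conj_W'[OF generator(1) assms(2)] .
  then have "lie_bracket (X u) B' \<in> W"
    using generator by (intro bracket_mem_W skew matexp_in_K)
  then have "adjoint_mat h ** lie_bracket (X u) B' ** h \<in> W" by (rule conj_W[OF generator(1)])
  moreover have "adjoint_mat h ** lie_bracket (X u) B' ** h = lie_bracket (adjoint_mat h ** X u ** h) B"
    using unitary_cancel[OF S_unitary[OF generator(1)]]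
    by (simp add: lie_bracket_def B'_def mm.diff_left mm.diff_right flip: matrix_mul_assoc)
  ultimately show ?case by simp
qed

text \<open>\<open>g\<close> is a product of flows with positive durations. \<open>B\<close>
  collects its velocities translated to the identity: differentiating \<open>g\<close> in the
  duration of one factor gives \<open>g ** b\<close> for some \<open>b\<close> in
  \<open>B\<close>.\<close>

inductive word where
  empty: "word (mat 1) {}"
| append: "word g B \<Longrightarrow> u \<in> U \<Longrightarrow> 0 < t \<Longrightarrow> word (matexp (X u) t ** g) (insert (adjoint_mat g ** X u ** g) B)"

lemma word_in_S: "word g B \<Longrightarrow> g \<in> S"
  by (induction rule: word.induct) (auto intro: S.intros)

lemma word_finite: "word g B \<Longrightarrow> finite B"
  by (induction rule: word.induct) auto

lemma word_subset: "word g B \<Longrightarrow> B \<subseteq> W"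
  by (induction rule: word.induct) (auto intro: conj_X_in_W word_in_S)

lemma word_extend:
  assumes "h \<in> S" "word g B"
  shows "\<exists>B'. B \<subseteq> B' \<and> word (h ** g) B'"
  using assms
proof (induction rule: S.induct)
  case (step h u t)
  then obtain B' where "B \<subseteq> B'" "word (h ** g) B'" by blast
  then show ?case
    using word.append[OF _ step(2,3), of "h ** g" B']
    by (intro exI[of _ "insert (adjoint_mat (h ** g) ** X u ** (h ** g)) B'"]) (auto simp: matrix_mul_assoc)
qed auto

text \<open>A word whose velocities span a subspace of maximal dimension already spans \<^term>\<open>W\<close>: prolonging it
  by any \<^term>\<open>h\<close> in the semigroup adds the velocities of \<^term>\<open>h\<close>, conjugated by the word.\<close>

lemma exists_spanning_word: "\<exists>g B. word g B \<and> span B = W"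
proof -
  define d where "d = (\<lambda>(g :: complex^'n^'n, B :: (complex^'n^'n) set). dim B)"
  have "\<exists>p. case_prod word p \<and> (\<forall>p'. case_prod word p' \<longrightarrow> d p' \<le> d p)"
    by (rule ex_has_greatest_nat[where k="(mat 1, {})" and b="Suc DIM(complex^'n^'n)"])
      (use dim_subset_UNIV in \<open>auto simp: d_def word.empty less_Suc_eq_le simp del: DIM_cart\<close>)
  then obtain g B where w: "word g B" and max: "\<And>g' B'. word g' B' \<Longrightarrow> dim B' \<le> dim B"
    by (auto simp: d_def)
  have "adjoint_mat g ** A ** g \<in> span B" if "A \<in> W" for A
    using that
  proof (induction rule: W_induct)
    case subspace
    have "subspace (span B)" by simp
    then show ?case
      by (auto simp: subspace_def mm.add_left mm.add_right mm.scaleR_left mm.scaleR_right)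
  next
    case (generator h u)
    define v where "v = adjoint_mat (h ** g) ** X u ** (h ** g)"
    obtain B' where B': "B \<subseteq> B'" "word (h ** g) B'" using word_extend[OF generator(1) w] by blast
    have "dim (insert v B) \<le> dim (insert v B')" using B' by (intro dim_subset) auto
    \<comment> \<open>The last duration is irrelevant to the velocity that is added; 1 is an
      arbitrary positive choice.\<close>
    also have "\<dots> \<le> dim B"
      using max[OF word.append[OF B'(2) generator(2), of 1]] by (simp add: v_def)
    finally have "v \<in> span B" by (simp add: dim_insert split: if_splits)
    then show ?case by (simp add: v_def adjoint_mat_mult matrix_mul_assoc)
  qed
  then have "(\<lambda>A. adjoint_mat g ** A ** g) ` W \<subseteq> span B" by (intro image_subsetI)
  then have "W \<subseteq> span B" by (simp only: conj_W_image[OF word_in_S[OF w]])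
  moreover have "span B \<subseteq> W" using word_subset[OF w] subspace_W by (simp add: span_minimal)
  ultimately show ?thesis using w by blast
qed

text \<open>The durations of the factors are made to depend on \<open>y\<close> to first order, with
  prescribed coefficients \<open>c b\<close>. The order of the factors is kept, and only the
  derivative at 0 is computed.\<close>

lemma word_family:
  fixes c :: "complex^'n^'n \<Rightarrow> 'y::real_normed_vector \<Rightarrow> real"
  assumes "word g B" and c: "\<And>b. bounded_linear (c b)"
  shows "\<exists>\<phi>. continuous_on UNIV \<phi> \<and> \<phi> 0 = g \<and> (\<exists>d>0. \<forall>y. norm y < d \<longrightarrow> \<phi> y \<in> S)
     \<and> (\<phi> has_derivative (\<lambda>y. g ** (\<Sum>b\<in>B. c b y *\<^sub>R b))) (at 0)"
  using assms(1)
proof (induction rule: word.induct)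
  case empty
  show ?case by (rule exI[of _ "\<lambda>y. mat 1"]) (auto intro: S.one exI[of _ 1] simp: mm.zero_right)
next
  case (append g B u t)
  obtain \<phi> d where \<phi>: "continuous_on UNIV \<phi>" "\<phi> 0 = g" "d > 0" "\<And>y. norm y < d \<Longrightarrow> \<phi> y \<in> S"
    "(\<phi> has_derivative (\<lambda>y. g ** (\<Sum>b\<in>B. c b y *\<^sub>R b))) (at 0)"
    using append.IH by blast
  define v where "v = adjoint_mat g ** X u ** g"
  \<comment> \<open>\<open>B\<close> is a set, so a velocity that already occurred must not be
    counted twice; the new factor then keeps its duration.\<close>
  define l where "l = (if v \<in> B then (\<lambda>y. 0) else c v)"
  have l: "bounded_linear l" using c by (simp add: l_def)
  have l0: "l 0 = 0" using linear_0[OF bounded_linear.linear[OF l]] .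
  define E where "E = matexp (X u)"
  have Ecomm: "E t ** X u = X u ** E t"
    unfolding E_def by (rule matexp_commute[OF skew[OF append.hyps(2)] refl])
  have Econt: "continuous_on UNIV E"
    unfolding E_def using matexp_has_vector_derivative
    by (auto intro!: continuous_at_imp_continuous_on has_vector_derivative_continuous)
  define \<phi>' where "\<phi>' y = E (t + l y) ** \<phi> y" for y
  have "continuous_on UNIV \<phi>'"
    unfolding \<phi>'_def
    by (intro mm.continuous_on \<phi>(1) continuous_on_compose2[OF Econt] continuous_intros
        bounded_linear.continuous_on[OF l]) auto
  moreover have "\<phi>' 0 = E t ** g" by (simp add: \<phi>'_def l0 \<phi>(2))
  moreover have "\<exists>d'>0. \<forall>y. norm y < d' \<longrightarrow> \<phi>' y \<in> S"
  proof -
    have "(l \<longlongrightarrow> l 0) (at 0)" using bounded_linear.tendsto[OF l tendsto_ident_at] .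
    \<comment> \<open>Here positivity of \<open>t\<close> is used: a small perturbation leaves the
      duration positive, so the product stays in \<open>S\<close>.\<close>
    then obtain d1 where d1: "d1 > 0" "\<And>y. norm y < d1 \<Longrightarrow> \<bar>l y\<bar> < t"
      using append.hyps(3) unfolding LIM_def l0 by (auto simp: l0 dist_norm) (metis abs_zero l0)
    have "0 < t + l y" if "norm y < d1" for y using d1(2)[OF that] by linarith
    then show ?thesis
      using \<phi>(3,4) d1(1) by (intro exI[of _ "min d d1"]) (auto simp: \<phi>'_def E_def intro!: S.step append.hyps(2))
  qed
  moreover have "(\<phi>' has_derivative (\<lambda>y. (E t ** g) ** (\<Sum>b\<in>insert v B. c b y *\<^sub>R b))) (at 0)"
  proof -
    have "((\<lambda>y. t + l y) has_derivative l) (at 0)"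
      using bounded_linear_imp_has_derivative[OF l] by (auto intro!: derivative_eq_intros)
    moreover have "(E has_derivative (\<lambda>h. h *\<^sub>R (X u ** E t))) (at (t + l 0))"
      using matexp_has_vector_derivative[of "X u" t] by (simp add: E_def l0 has_vector_derivative_def)
    ultimately have "((\<lambda>y. E (t + l y)) has_derivative (\<lambda>y. l y *\<^sub>R (X u ** E t))) (at 0)"
      using diff_chain_at[of "\<lambda>y. t + l y" l 0 E] by (simp add: o_def)
    from mm.FDERIV[OF this \<phi>(5)]
    have "(\<phi>' has_derivative (\<lambda>y. E t ** (g ** (\<Sum>b\<in>B. c b y *\<^sub>R b)) + (l y *\<^sub>R (X u ** E t)) ** g)) (at 0)"
      by (simp add: \<phi>'_def[abs_def] l0 \<phi>(2))
    moreover have "E t ** (g ** (\<Sum>b\<in>B. c b y *\<^sub>R b)) + (l y *\<^sub>R (X u ** E t)) ** g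
        = (E t ** g) ** (\<Sum>b\<in>insert v B. c b y *\<^sub>R b)" for y
    proof -
      have "(\<Sum>b\<in>insert v B. c b y *\<^sub>R b) = (\<Sum>b\<in>B. c b y *\<^sub>R b) + l y *\<^sub>R v"
        using word_finite[OF append.hyps(1)] by (simp add: l_def insert_absorb sum.insert_if add.commute)
      moreover have "(E t ** g) ** v = (X u ** E t) ** g"
        using unitary_cancel[OF S_unitary[OF word_in_S[OF append.hyps(1)]]] Ecomm
        by (simp add: v_def flip: matrix_mul_assoc) (simp add: matrix_mul_assoc)
      ultimately show ?thesis
        by (simp add: mm.add_right mm.scaleR_right mm.scaleR_left matrix_mul_assoc)
    qed
    ultimately show ?thesis by simp
  qed
  ultimately show ?case unfolding v_def E_def by blast
qed

text \<open>As the velocities span \<open>W\<close>, coefficients can be chosen on a basis of the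
  parameter space and extended linearly. The set \<open>B\<close> may be dependent, hence the
  choice.\<close>

lemma word_family_linear:
  fixes \<Lambda> :: "'y::euclidean_space \<Rightarrow> complex^'n^'n"
  assumes w: "word g B" "span B = W" and lin: "linear \<Lambda>" and W: "\<And>y. \<Lambda> y \<in> W"
  obtains \<phi> d where "continuous_on UNIV \<phi>" "\<phi> 0 = g" "d > 0" "\<And>y. norm y < d \<Longrightarrow> \<phi> y \<in> S"
    "(\<phi> has_derivative (\<lambda>y. g ** \<Lambda> y)) (at 0)"
proof -
  have "\<exists>a. \<Lambda> e = (\<Sum>b\<in>B. a b *\<^sub>R b)" for e
    using W[of e] w span_finite[OF word_finite[OF w(1)]] by auto
  then obtain a where a: "\<And>e. \<Lambda> e = (\<Sum>b\<in>B. a e b *\<^sub>R b)" by metis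
  define c where "c b y = (\<Sum>e\<in>Basis. (y \<bullet> e) * a e b)" for b and y :: 'y
  have "bounded_linear (c b)" for b
    unfolding c_def by (intro bounded_linear_sum bounded_linear_mult_const bounded_linear_inner_left)
  then obtain \<phi> where \<phi>: "continuous_on UNIV \<phi>" "\<phi> 0 = g"
    "\<exists>d>0. \<forall>y. norm y < d \<longrightarrow> \<phi> y \<in> S" "(\<phi> has_derivative (\<lambda>y. g ** (\<Sum>b\<in>B. c b y *\<^sub>R b))) (at 0)"
    using word_family[OF w(1), of c] by auto
  from \<phi>(3) obtain d where d: "d > 0" "\<And>y. norm y < d \<Longrightarrow> \<phi> y \<in> S" by blast
  have "(\<Sum>b\<in>B. c b y *\<^sub>R b) = \<Lambda> y" for y
  proof -
    have "(\<Sum>b\<in>B. c b y *\<^sub>R b) = (\<Sum>b\<in>B. \<Sum>e\<in>Basis. (y \<bullet> e) *\<^sub>R a e b *\<^sub>R b)"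
      by (simp add: c_def scaleR_sum_left)
    also have "\<dots> = (\<Sum>e\<in>Basis. (y \<bullet> e) *\<^sub>R \<Lambda> e)"
      by (subst sum.swap) (simp add: a scaleR_sum_right)
    also have "\<dots> = \<Lambda> (\<Sum>e\<in>Basis. (y \<bullet> e) *\<^sub>R e)"
      by (simp add: linear_sum[OF lin] linear_scale[OF lin])
    finally show ?thesis by (simp add: euclidean_representation)
  qed
  then show ?thesis using that[of \<phi> d] \<phi> d by simp
qed

end

section \<open>Actions on the state space\<close>

text \<open>One setting for both systems: \<open>act\<close> is the matrix product on the group and
  the matrix-vector product on the sphere.\<close>

locale skew_action = skew_system X U
  for X :: "'u::euclidean_space \<Rightarrow> complex^'n^'n" and U :: "'u set" +
  fixes act :: "complex^'n^'n \<Rightarrow> 'x::euclidean_space \<Rightarrow> 'x"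
  assumes act_bilinear: "bounded_bilinear act"
    and act_act: "act A (act B x) = act (A ** B) x"
    and act_one: "act (mat 1) x = x"
    and norm_act_unitary: "g \<in> unitary_group \<Longrightarrow> norm (act g x) = norm x"
begin

sublocale act: bounded_bilinear act
  by (rule act_bilinear)

text \<open>The orbit of \<open>q0\<close> under the compact group \<open>K\<close> is closed and
  invariant under each frozen flow, and these flows are isometries; so solutions with measurable
  controls cannot leave it either.\<close>

lemma reachable_subset_orbit:
  assumes "q \<in> reachable_set (\<lambda>u. act (X u)) M U q0"
  shows "\<exists>g\<in>K. q = act g q0"
proof -
  obtain T u c where T: "0 \<le> T" and adm: "admissible_control U T u"
    and sol: "is_solution (\<lambda>u. act (X u)) M T u q0 c" and q: "q = c T"
    using assms by (auto simp: reachable_set_def)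
  define C where "C = (\<lambda>g. act g q0) ` K"
  have "c T \<in> C"
  proof (rule solution_stays_in_closed_invariant_set[OF sol T, where U=U and \<Phi>="\<lambda>w h. act (matexp (X w) h)"])
    show "u t \<in> U" if "t \<in> {0..T}" for t using adm that by (simp add: admissible_control_def)
    show "closed C"
      unfolding C_def by (intro compact_imp_closed compact_continuous_image compact_K act.continuous_on continuous_intros)
    have "mat 1 \<in> K" using S.one S_subset_K by blast
    then show "q0 \<in> C" unfolding C_def by (intro image_eqI[of _ _ "mat 1"]) (auto simp: act_one)
    show "act (matexp (X w) h) x \<in> C" if "w \<in> U" "0 \<le> h" "x \<in> C" for w h x
      using that K_mult[OF matexp_in_K] by (auto simp: C_def act_act)
    show "dist (act (matexp (X w) h) x) (act (matexp (X w) h) y) \<le> dist x y" if "w \<in> U" for w h x y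
      using norm_act_unitary[OF matexp_unitary[OF skew[OF that]], of h "x - y"]
      by (simp add: dist_norm act.diff_right)
    show "bounded_linear (act (X w))" for w by (rule act.bounded_linear_right)
    show "\<exists>d>0. \<forall>h x. 0 \<le> h \<and> h < d \<longrightarrow>
        norm (act (matexp (X w) h) x - x - h *\<^sub>R act (X w) x) \<le> e * h * norm x" if "0 < e" for w e
    proof -
      obtain C where C: "C > 0" "\<And>A x. norm (act A x) \<le> norm A * norm x * C"
        using act.pos_bounded by auto
      have "(matexp (X w) has_derivative (\<lambda>h. h *\<^sub>R X w)) (at 0)"
        using matexp_has_vector_derivative[of "X w" 0] by (simp add: has_vector_derivative_def)
      moreover have "e / C > 0" using that C by simp
      ultimately obtain d where d: "d > 0"
        "\<And>h. norm (h - 0) < d \<Longrightarrow> norm (matexp (X w) h - matexp (X w) 0 - (h - 0) *\<^sub>R X w) \<le> e / C * norm (h - 0)"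
        unfolding has_derivative_at_alt by blast
      have "norm (act (matexp (X w) h) x - x - h *\<^sub>R act (X w) x) \<le> e * h * norm x" if "0 \<le> h" "h < d" for h x
      proof -
        have "act (matexp (X w) h) x - x - h *\<^sub>R act (X w) x = act (matexp (X w) h - mat 1 - h *\<^sub>R X w) x"
          by (simp add: act.diff_left act.scaleR_left act_one)
        also have "norm \<dots> \<le> norm (matexp (X w) h - mat 1 - h *\<^sub>R X w) * norm x * C" by (rule C)
        also have "\<dots> \<le> (e / C * h) * norm x * C"
          using d(2)[of h] that C by (intro mult_right_mono) auto
        finally show ?thesis using C by simp
      qed
      then show ?thesis using d(1) by blast
    qed
  qed
  then show ?thesis using q by (auto simp: C_def)
qed

lemma reachable_act:
  assumes M: "\<And>g x. g \<in> S \<Longrightarrow> x \<in> M \<Longrightarrow> act g x \<in> M"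
    and g: "g \<in> S" and p: "p \<in> reachable_set (\<lambda>u. act (X u)) M U q0"
  shows "act g p \<in> reachable_set (\<lambda>u. act (X u)) M U q0"
  using g
proof (induction rule: S.induct)
  case one
  then show ?case using p by (simp add: act_one)
next
  case (step g u t)
  define c where "c s = act (matexp (X u) s) (act g p)" for s
  have der: "(c has_vector_derivative act (X u) (c s)) (at s)" for s
    using bounded_linear.has_vector_derivative[OF act.bounded_linear_left[of "act g p"]
        matexp_has_vector_derivative[of "X u" s]]
    by (simp add: c_def[abs_def] act_act matrix_mul_assoc)
  then have "continuous_on UNIV c"
    by (auto intro!: continuous_at_imp_continuous_on has_vector_derivative_continuous)
  then have cont: "continuous_on UNIV (\<lambda>s. act (X u) (c s))"
    by (intro act.continuous_on continuous_intros)
  have "p \<in> M"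
    using p by (auto simp: reachable_set_def is_solution_def)
  then have cM: "c s \<in> M" if "0 \<le> s" for s
    using that step by (auto simp: c_def intro!: M matexp_in_S)
  have c0: "c 0 = act g p" by (simp add: c_def act_one)
  have "c t \<in> reachable_set (\<lambda>u. act (X u)) M U q0"
    using reachable_set_append[OF step.IH step.hyps(2) _ c0 der cont cM] step.hyps(3) by simp
  then show ?case by (simp add: c_def act_act)
qed

text \<open>The factor \<^term>\<open>R\<close> moves the family \<open>\<phi>(y)\<^sup>* q1\<close> off \<^term>\<open>M\<close>, so that the open mapping theorem applies in
  the ambient space; by \<open>sep\<close> the factor is trivial whenever the product lies on \<^term>\<open>M\<close>.\<close>

lemma reachable_if_dense:
  fixes R R' :: "'x \<Rightarrow> complex^'n^'n" and \<Lambda> :: "'x \<Rightarrow> complex^'n^'n"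
  assumes M: "\<And>g x. g \<in> S \<Longrightarrow> x \<in> M \<Longrightarrow> act g x \<in> M"
    and M': "\<And>g x. g \<in> S \<Longrightarrow> x \<in> M \<Longrightarrow> act (adjoint_mat g) x \<in> M"
    and dense: "M \<subseteq> closure (reachable_set (\<lambda>u. act (X u)) M U q0)"
    and q1: "q1 \<in> M" and w: "word g B" "span B = W"
    and R: "continuous_on UNIV R" "R 0 = mat 1" "(R has_derivative R') (at 0)"
    and \<Lambda>: "linear \<Lambda>" "\<And>y. \<Lambda> y \<in> W"
    and id: "\<And>y. act (R' y - \<Lambda> y) (act (adjoint_mat g) q1) = y"
    and sep: "d0 > 0" "\<And>y z. norm y < d0 \<Longrightarrow> z \<in> M \<Longrightarrow> act (R y) z \<in> M \<Longrightarrow> act (R y) z = z"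
  shows "q1 \<in> reachable_set (\<lambda>u. act (X u)) M U q0"
proof -
  obtain \<phi> d where \<phi>: "continuous_on UNIV \<phi>" "\<phi> 0 = g" "d > 0" "\<And>y. norm y < d \<Longrightarrow> \<phi> y \<in> S"
    "(\<phi> has_derivative (\<lambda>y. g ** \<Lambda> y)) (at 0)"
    using word_family_linear[OF w \<Lambda>] by metis
  define \<psi> where "\<psi> = act (adjoint_mat g) q1"
  have gS: "g \<in> S" by (rule word_in_S[OF w(1)])
  \<comment> \<open>Where \<open>R y\<close> acts trivially, \<open>f y\<close> is a point from
    which \<open>\<phi> y\<close>, a product of forward flows, steers exactly to
    \<open>q1\<close>.\<close>
  define f where "f y = act (R y ** adjoint_mat (\<phi> y)) q1" for y
  have f0: "f 0 = \<psi>" by (simp add: f_def R \<phi> \<psi>_def)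
  have fcont: "continuous_on UNIV f"
    unfolding f_def
    by (intro act.continuous_on mm.continuous_on adj_continuous_on R \<phi> continuous_intros)
  have fder: "(f has_derivative id) (at 0)"
  proof -
    have "((\<lambda>y. R y ** adjoint_mat (\<phi> y)) has_derivative
        (\<lambda>y. R 0 ** adjoint_mat (g ** \<Lambda> y) + R' y ** adjoint_mat (\<phi> 0))) (at 0)"
      by (rule mm.FDERIV[OF R(3) adj_has_derivative[OF \<phi>(5)]])
    from bounded_linear.has_derivative[OF act.bounded_linear_left this]
    have "(f has_derivative (\<lambda>y. act (R 0 ** adjoint_mat (g ** \<Lambda> y) + R' y ** adjoint_mat (\<phi> 0)) q1)) (at 0)"
      by (simp add: f_def[abs_def])
    moreover have "act (R 0 ** adjoint_mat (g ** \<Lambda> y) + R' y ** adjoint_mat (\<phi> 0)) q1 = y" for y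
    proof -
      \<comment> \<open>Taking adjoints turns the velocity into its negative; this is the origin of
        the difference \<open>R' y - \<Lambda> y\<close> in the hypothesis
        \<open>id\<close>.\<close>
      have "adjoint_mat (\<Lambda> y) = - \<Lambda> y" using W_skew[OF \<Lambda>(2)] by (simp add: skew_hermitian_def)
      then have "R 0 ** adjoint_mat (g ** \<Lambda> y) + R' y ** adjoint_mat (\<phi> 0) = (R' y - \<Lambda> y) ** adjoint_mat g"
        by (simp add: R(2) \<phi>(2) adjoint_mat_mult mm.diff_left mm.minus_left)
      then show ?thesis using id[of y] by (simp add: act_act)
    qed
    ultimately show ?thesis by (simp add: id_def)
  qed
  \<comment> \<open>Sussmann's open mapping theorem asks for continuity and for a surjective
    derivative at the single point 0, so no continuous differentiability of the family has to be
    shown.\<close>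
  have "f 0 \<in> interior (f ` ball 0 (min d d0))"
    by (rule sussmann_open_mapping[OF open_UNIV fcont _ fder bounded_linear_ident])
      (use \<phi>(3) sep(1) in \<open>auto simp: id_def\<close>)
  then obtain e where e: "e > 0" "ball \<psi> e \<subseteq> f ` ball 0 (min d d0)"
    by (auto simp: mem_interior f0)
  have "\<psi> \<in> M" unfolding \<psi>_def using M'[OF gS q1] .
  then have "\<psi> \<in> closure (reachable_set (\<lambda>u. act (X u)) M U q0)" using dense by blast
  then obtain r where r: "r \<in> reachable_set (\<lambda>u. act (X u)) M U q0" "dist r \<psi> < e"
    using e(1) by (auto simp: closure_approachable)
  then have "r \<in> f ` ball 0 (min d d0)" using e(2) by (auto simp: dist_commute)
  then obtain y where y: "norm y < d" "norm y < d0" "r = f y" by auto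
  have rM: "r \<in> M" using r(1) by (auto simp: reachable_set_def is_solution_def)
  define z where "z = act (adjoint_mat (\<phi> y)) q1"
  have zM: "z \<in> M" unfolding z_def using M'[OF \<phi>(4)[OF y(1)] q1] .
  have "r = act (R y) z" by (simp add: y(3) f_def z_def act_act)
  then have "r = z" using sep(2)[OF y(2) zM] rM by simp
  then have "act (\<phi> y) r = q1"
    using S_unitary[OF \<phi>(4)[OF y(1)]] by (simp add: z_def act_act unitary_cancel act_one)
  then show ?thesis using reachable_act[OF M \<phi>(4)[OF y(1)] r(1)] by simp
qed

end

section \<open>Controllability on the unitary groups\<close>

lemma commute_all_scalar:
  fixes Y :: "complex^'n^'n"
  assumes "\<And>Z. Y ** Z = Z ** Y"
  shows "\<exists>c. Y = mat c"
proof -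
  have *: "Y $ a $ j = (if a = j then Y $ k $ k else 0)" for a j k
  proof -
    \<comment> \<open>A matrix unit: the entries at \<open>(a, k)\<close> of \<open>Y ** E\<close>
      and \<open>E ** Y\<close> isolate \<open>Y $ a $ j\<close> and the diagonal entry
      \<open>Y $ k $ k\<close>.\<close>
    define E :: "complex^'n^'n" where "E = (\<chi> a b. if a = j \<and> b = k then 1 else 0)"
    have "(Y ** E) $ a $ k = (\<Sum>l\<in>UNIV. if l = j then Y $ a $ l else 0)"
      by (simp add: matrix_matrix_mult_def E_def if_distrib[where f="\<lambda>x. _ * x"] cong: if_cong)
    moreover have "(E ** Y) $ a $ k = (\<Sum>l\<in>UNIV. if l = k then (if a = j then Y $ l $ k else 0) else 0)"
      by (cases "a = j") (simp_all add: matrix_matrix_mult_def E_def if_distrib[where f="\<lambda>x. x * _"] cong: if_cong)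
    ultimately show ?thesis using assms[of E] by simp
  qed
  fix k
  have "Y = mat (Y $ k $ k)"
    unfolding vec_eq_iff mat_def using * by simp
  then show ?thesis ..
qed

lemma commute_skew_scalar:
  fixes Y :: "complex^'n^'n"
  assumes "\<And>Z. skew_hermitian Z \<Longrightarrow> Y ** Z = Z ** Y"
  shows "\<exists>c. Y = mat c"
proof (rule commute_all_scalar)
  fix Z :: "complex^'n^'n"
  define A where "A = Z - adjoint_mat Z"
  define B where "B = mat (- \<i>) ** (Z + adjoint_mat Z)"
  have "skew_hermitian A" by (simp add: skew_hermitian_def A_def adj_diff)
  moreover have "skew_hermitian B"
    by (simp add: skew_hermitian_def B_def adj_add adjoint_mat_mult mat_mult_commute[symmetric])
      (simp add: vec_eq_iff mat_mult_nth)
  ultimately have "Y ** A = A ** Y" "Y ** B = B ** Y" using assms by auto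
  moreover have "2 *\<^sub>R Z = A + mat \<i> ** B"
    by (simp add: A_def B_def vec_eq_iff mat_mult_nth algebra_simps scaleR_2)
  moreover have "Y ** (mat \<i> ** B) = mat \<i> ** (Y ** B)"
    by (metis matrix_mul_assoc mat_mult_commute)
  ultimately have "Y ** (2 *\<^sub>R Z) = (2 *\<^sub>R Z) ** Y"
    by (simp add: mm.add_left mm.add_right matrix_mul_assoc)
  then show "Y ** Z = Z ** Y" by (simp add: mm.scaleR_left mm.scaleR_right)
qed

section \<open>Traces, and the scalar complement of the span\<close>

lemma trace_adjoint_mat: "trace (adjoint_mat A) = cnj (trace A)"
  by (simp add: trace_def adjoint_mat_def)

lemma trace_mat: "trace (mat c :: complex^'n^'n) = of_nat CARD('n) * c"
  by (simp add: trace_def mat_def)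

lemma trace_skew: "skew_hermitian A \<Longrightarrow> cnj (trace A) = - trace A"
  using trace_adjoint_mat[of A] by (simp add: skew_hermitian_def trace_def sum_negf)

lemma det_mat: "det (mat c :: complex^'n^'n) = c ^ CARD('n)"
  by (subst det_diagonal) (auto simp: mat_def)

context skew_system
begin

text \<open>Put N = [Y, A]. Skewness of the bracket with \<open>A\<close> gives <N, N> = <Y,
  [A, N]>, and this is 0 because [A, N] lies in \<open>W\<close>.\<close>

lemma bracket_orthogonal_W:
  assumes orth: "\<And>B. B \<in> W \<Longrightarrow> Y \<bullet> B = 0" and norm: "\<And>A. A \<in> W \<Longrightarrow> lie_bracket Y A \<in> W"
    and A: "A \<in> W"
  shows "Y ** A = A ** Y"
proof -
  define N where "N = lie_bracket Y A"
  have "lie_bracket A Y \<bullet> N = - (Y \<bullet> lie_bracket A N)" by (rule inner_lie_bracket[OF W_skew[OF A]])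
  also have "\<dots> = 0" using orth[OF bracket_W[OF A]] norm[OF A] by (simp add: N_def)
  finally have "N \<bullet> N = 0" using lie_bracket_commute[of Y A] by (simp add: N_def)
  then show ?thesis by (simp add: N_def lie_bracket_def)
qed

lemma W_decomp:
  assumes "skew_hermitian Z"
  obtains P Y where "P \<in> W" "skew_hermitian Y" "\<And>B. B \<in> W \<Longrightarrow> Y \<bullet> B = 0" "Z = P + Y"
proof -
  obtain P Y where PY: "P \<in> span W" "\<And>w. w \<in> span W \<Longrightarrow> orthogonal Y w" "Z = P + Y"
    using orthogonal_subspace_decomp_exists[of W Z] by metis
  have span: "span W = W" using subspace_W by simp
  have "skew_hermitian Y"
    using assms W_skew[of P] PY span unfolding skew_hermitian_def
    by (metis add_diff_cancel_left' adj_diff minus_diff_minus)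
  then show ?thesis using that PY span by (auto simp: orthogonal_def)
qed

lemma trace_W:
  assumes "\<And>u. u \<in> U \<Longrightarrow> trace (X u) = 0" "A \<in> W"
  shows "trace A = 0"
  using assms(2)
proof (induction rule: W_induct)
  case subspace
  show ?case by (auto simp: subspace_def trace_def sum.distrib scaleR_sum_right[symmetric])
next
  case (generator h u)
  have "trace (adjoint_mat h ** X u ** h) = trace (X u ** h ** adjoint_mat h)"
    using trace_mul_sym[of "adjoint_mat h" "X u ** h"] by (simp add: matrix_mul_assoc)
  also have "\<dots> = trace (X u)"
    using unitary_cancel(2)[OF S_unitary[OF generator(1)]] by (simp flip: matrix_mul_assoc)
  finally show ?case using assms(1) generator by simp
qed

lemma S_special_unitary:
  assumes tr: "\<And>u. u \<in> U \<Longrightarrow> trace (X u) = 0" and "g \<in> S"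
  shows "g \<in> special_unitary_group"
  using assms(2)
proof (induction rule: S.induct)
  case (step g u t)
  then show ?case
    using matexp_special_unitary[OF skew[of u] tr[of u], of t]
    by (simp add: special_unitary_group_def unitary_mult det_mul)
qed (simp add: special_unitary_group_def)

text \<open>Trace-free skew matrices have exponentials in \<open>K\<close>, so bracketing with them
  preserves \<open>W\<close>. The part \<open>Y\<close> orthogonal to \<open>W\<close> therefore
  commutes with \<open>W\<close>, by the commutant condition with SU(n), and after differentiation
  with all skew matrices.\<close>

lemma skew_decomp_scalar:
  fixes Z :: "complex^'n^'n"
  assumes SU: "special_unitary_group \<subseteq> K" and Z: "skew_hermitian Z"
  obtains P c where "P \<in> W" "cnj c = - c" "\<And>B. B \<in> W \<Longrightarrow> mat c \<bullet> B = 0" "Z = P + mat c"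
proof -
  \<comment> \<open>The scalar with the same trace as \<open>Y\<close>. Subtracting it changes no
    bracket but brings the exponential into SU(n).\<close>
  define z where "z Y = trace Y / of_nat CARD('n)" for Y :: "complex^'n^'n"
  have traceless: "skew_hermitian (Y - mat (z Y))" "trace (Y - mat (z Y)) = 0" if "skew_hermitian Y" for Y
    using that trace_skew[OF that]
    by (auto simp: skew_hermitian_def adj_diff z_def trace_sub trace_mat)
      (auto simp: vec_eq_iff mat_def)
  have bracket: "lie_bracket Y A \<in> W" if "skew_hermitian Y" "A \<in> W" for Y A
  proof -
    have "lie_bracket (Y - mat (z Y)) A \<in> W"
      using traceless[OF that(1)] SU that(2) by (intro bracket_mem_W) (auto intro: matexp_special_unitary)
    then show ?thesis by (simp add: lie_bracket_def mm.diff_left mm.diff_right mat_mult_commute)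
  qed
  obtain P Y where PY: "P \<in> W" "skew_hermitian Y" "\<And>B. B \<in> W \<Longrightarrow> Y \<bullet> B = 0" "Z = P + Y"
    using W_decomp[OF Z] by blast
  have comm: "Y ** A = A ** Y" if "A \<in> W" for A
    using bracket_orthogonal_W[OF PY(3) bracket[OF PY(2)] that] by blast
  have "Y ** Q = Q ** Y" if Q: "skew_hermitian Q" for Q
  proof -
    define Q' where "Q' = Q - mat (z Q)"
    have Q': "skew_hermitian Q'" "trace Q' = 0" using traceless[OF Q] by (simp_all add: Q'_def)
    have eq: "Y ** matexp Q' t = matexp Q' t ** Y" for t
      using K_commute[OF _ comm] SU matexp_special_unitary[OF Q'] by blast
    have "((\<lambda>t. Y ** matexp Q' t) has_vector_derivative Y ** Q') (at 0)"
      using bounded_linear.has_vector_derivative[OF mm.bounded_linear_right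
          matexp_has_vector_derivative[of Q' 0]] by simp
    moreover have "((\<lambda>t. matexp Q' t ** Y) has_vector_derivative Q' ** Y) (at 0)"
      using bounded_linear.has_vector_derivative[OF mm.bounded_linear_left
          matexp_has_vector_derivative[of Q' 0]] by simp
    ultimately have "Y ** Q' = Q' ** Y" unfolding eq by (rule vector_derivative_unique_at)
    then show ?thesis by (simp add: Q'_def mm.diff_left mm.diff_right mat_mult_commute)
  qed
  then obtain c where c: "Y = mat c" using commute_skew_scalar by blast
  have "cnj c = - c"
  proof -
    fix k :: 'n
    have "mat (cnj c) $ k $ k = (- mat c :: complex^'n^'n) $ k $ k"
      using PY(2) unfolding c skew_hermitian_def adjoint_mat_mat by simp
    then show ?thesis by (simp add: mat_def)
  qed
  then show ?thesis using that[OF PY(1), of c] PY c by simp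
qed

lemma traceless_skew_in_W:
  assumes SU: "special_unitary_group \<subseteq> K" and Z: "skew_hermitian Z" "trace Z = 0"
    and tr: "\<And>u. u \<in> U \<Longrightarrow> trace (X u) = 0"
  shows "Z \<in> W"
proof -
  obtain P c where "P \<in> W" "Z = P + mat c"
    using skew_decomp_scalar[OF SU Z(1)] by blast
  moreover from this have "c = 0"
    using trace_W[OF tr, of P] Z(2) by (simp add: trace_add trace_mat)
  ultimately show ?thesis by simp
qed

text \<open>The inner product of \<open>mat c\<close> with \<open>X u\<close> is Re(c * cnj(trace(X
  u))). Both \<open>c\<close> and the nonzero trace are purely imaginary, so its vanishing forces
  \<open>c = 0\<close>.\<close>

lemma skew_in_W:
  assumes SU: "special_unitary_group \<subseteq> K" and Z: "skew_hermitian Z"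
    and u: "u \<in> U" "trace (X u) \<noteq> 0"
  shows "Z \<in> W"
proof -
  obtain P c where P: "P \<in> W" "Z = P + mat c" "cnj c = - c" "\<And>B. B \<in> W \<Longrightarrow> mat c \<bullet> B = 0"
    using skew_decomp_scalar[OF SU Z(1)] by blast
  have "trace (mat c ** adjoint_mat (X u)) = c * cnj (trace (X u))"
    by (simp add: trace_def mat_mult_nth adjoint_mat_def sum_distrib_left)
  then have "Re (c * cnj (trace (X u))) = 0"
    using P(4)[OF X_in_W[OF u(1)]] by (simp add: inner_matrix)
  moreover have "Re c = 0" "Re (trace (X u)) = 0"
    using P(3) trace_skew[OF skew[OF u(1)]] by (auto simp: complex_eq_iff)
  ultimately have "c = 0" using u(2) by (auto simp: complex_eq_iff)
  then show ?thesis using P by simp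
qed

end

text \<open>The equation becomes h h = -2h, so a nonzero \<open>h\<close> has norm at least 2/C. It
  is applied to a Hermitian \<open>mat 1 + h\<close> that is also unitary.\<close>

lemma square_near_one:
  "\<exists>d>0. \<forall>h :: complex^'n^'n. norm h < d \<longrightarrow> (mat 1 + h) ** (mat 1 + h) = mat 1 \<longrightarrow> h = 0"
proof -
  obtain C where C: "C > 0" "\<And>(B :: complex^'n^'n) (D :: complex^'n^'n). norm (B ** D) \<le> norm B * norm D * C"
    using bounded_bilinear.pos_bounded[OF bounded_bilinear_matrix_mult[where 'n='n]] by auto
  have "h = 0" if h: "norm h < 2 / C" and eq: "(mat 1 + h) ** (mat 1 + h) = mat 1" for h :: "complex^'n^'n"
  proof (rule ccontr)
    assume "h \<noteq> 0"
    have "h ** h = - (2 *\<^sub>R h)"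
      using eq by (simp add: mm.add_left mm.add_right scaleR_2 algebra_simps add_eq_0_iff)
    then have "2 * norm h = norm (h ** h)" by simp
    also have "\<dots> \<le> norm h * norm h * C" by (rule C)
    finally have "2 \<le> norm h * C" using \<open>h \<noteq> 0\<close> by simp
    then show False using h C by (simp add: field_simps)
  qed
  then show ?thesis using C by (intro exI[of _ "2 / C"]) auto
qed

lemma group_exactly_controllable:
  fixes X :: "'u::euclidean_space \<Rightarrow> complex^'n^'n"
  assumes skew: "\<And>u. u \<in> U \<Longrightarrow> skew_hermitian (X u)"
    and G: "G = (if \<forall>u\<in>U. trace (X u) = 0 then special_unitary_group else unitary_group)"
    and approx: "approximately_controllable (\<lambda>u g. X u ** g) G U"
  shows "exactly_controllable (\<lambda>u g. X u ** g) G U"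
proof -
  interpret skew_action X U "(**) :: complex^'n^'n \<Rightarrow> complex^'n^'n \<Rightarrow> complex^'n^'n"
    by unfold_locales
      (auto intro: skew bounded_bilinear_matrix_mult norm_unitary_left simp: matrix_mul_assoc)
  have GU: "G \<subseteq> unitary_group" by (auto simp: G special_unitary_group_def)
  have SUG: "special_unitary_group \<subseteq> G" by (auto simp: G special_unitary_group_def)
  have G1: "mat 1 \<in> G" using SUG by (auto simp: special_unitary_group_def)
  have Gmult: "g ** h \<in> G" if "g \<in> G" "h \<in> G" for g h
    using that by (auto simp: G special_unitary_group_def unitary_mult det_mul split: if_splits)
  have Gadj: "adjoint_mat g \<in> G" if "g \<in> G" for g
  proof -
    have "det (adjoint_mat g) * det g = 1"
      using unitary_cancel(1)[of g] that GU by (auto simp flip: det_mul)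
    then show ?thesis
      using that by (auto simp: G special_unitary_group_def unitary_adjoint_mat split: if_splits)
  qed
  have SG: "S \<subseteq> G" using S_special_unitary S_unitary by (auto simp: G)
  \<comment> \<open>From the identity the orbit of \<open>K\<close> is \<open>K\<close> itself; it
    is closed, so density yields \<open>G \<subseteq> K\<close>.\<close>
  have "reachable_set (\<lambda>u g. X u ** g) G U (mat 1) \<subseteq> K"
    using reachable_subset_orbit[of _ G "mat 1"] by auto
  then have "G \<subseteq> K"
    using approx G1 closure_minimal[OF _ closed_K] unfolding approximately_controllable_def by blast
  then have SUK: "special_unitary_group \<subseteq> K" using SUG by blast
  have "q1 \<in> reachable_set (\<lambda>u g. X u ** g) G U q0" if q0: "q0 \<in> G" and q1: "q1 \<in> G" for q0 q1
  proof -
    obtain g B where w: "word g B" "span B = W" using exists_spanning_word by blast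
    define \<psi> where "\<psi> = adjoint_mat g ** q1"
    have "\<psi> \<in> G" unfolding \<psi>_def using word_in_S[OF w(1)] SG q1 by (intro Gmult Gadj) auto
    then have \<psi>: "\<psi> \<in> unitary_group" using GU by blast
    \<comment> \<open>A switch: in the trace-free case \<open>W\<close> misses the imaginary
      scalars, and these have to be supplied by the factor \<open>R\<close>.\<close>
    define \<kappa> where "\<kappa> = (if \<forall>u\<in>U. trace (X u) = 0 then 1 else 0 :: real)"
    define D where "D y = y ** adjoint_mat \<psi>" for y :: "complex^'n^'n"
    define h where "h y = (1/2) *\<^sub>R (D y + adjoint_mat (D y))" for y
    define k where "k y = (1/2) *\<^sub>R (D y - adjoint_mat (D y))" for y
    define \<theta> where "\<theta> y = \<kappa> * (Im (trace (D y)) / CARD('n))" for y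
    \<comment> \<open>\<open>D\<close> translates a vector at \<open>\<psi>\<close> to the identity
      and splits as \<open>h + k\<close> into Hermitian and skew parts. Hermitian matrices are
      normal to U(n), and imaginary scalars are in addition normal to SU(n) inside U(n);
      \<open>R\<close> moves along exactly these. The phase cancels in
      \<open>R' y - \<Lambda> y\<close>, which leaves \<open>D y\<close>.\<close>
    define R where "R y = (cos (\<theta> y) *\<^sub>R mat 1 + sin (\<theta> y) *\<^sub>R mat \<i>) ** (mat 1 + h y)" for y
    define R' where "R' y = h y + \<theta> y *\<^sub>R mat \<i>" for y
    define \<Lambda> where "\<Lambda> y = \<theta> y *\<^sub>R mat \<i> - k y" for y
    have D: "bounded_linear D" unfolding D_def[abs_def] by (rule mm.bounded_linear_left)
    have adjD: "bounded_linear (\<lambda>y. adjoint_mat (D y))"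
      by (rule bounded_linear_compose[OF bounded_linear_adjoint_mat D])
    have h: "bounded_linear h" and k: "bounded_linear k"
      unfolding h_def[abs_def] k_def[abs_def]
      by (intro bounded_linear_const_scaleR bounded_linear_add bounded_linear_sub D adjD)+
    have \<theta>: "bounded_linear \<theta>"
    proof -
      have "bounded_linear (\<lambda>A :: complex^'n^'n. Im (trace A))"
        unfolding linear_conv_bounded_linear[symmetric]
        by (auto intro!: linearI simp: trace_def sum.distrib sum_distrib_left)
      from bounded_linear_compose[OF this D] show ?thesis
        unfolding \<theta>_def[abs_def] by (intro bounded_linear_const_mult bounded_linear_divide[THEN bounded_linear_compose])
    qed
    have zero: "h 0 = 0" "\<theta> 0 = 0"
      using linear_0[OF bounded_linear.linear[OF h]] linear_0[OF bounded_linear.linear[OF \<theta>]] by auto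
    have adjh: "adjoint_mat (h y) = h y" for y by (simp add: h_def adj_scaleR adj_add add.commute)
    have adjk: "adjoint_mat (k y) = - k y" for y by (simp add: k_def adj_scaleR adj_diff flip: scaleR_minus_right)
    have adji: "adjoint_mat (\<theta> y *\<^sub>R mat \<i>) = - (\<theta> y *\<^sub>R mat \<i> :: complex^'n^'n)" for y
      by (simp add: adj_scaleR) (simp add: vec_eq_iff mat_def)
    have skew\<Lambda>: "skew_hermitian (\<Lambda> y)" for y
      by (simp add: skew_hermitian_def \<Lambda>_def adj_diff adji adjk)
    obtain d1 where d1: "d1 > 0"
      "\<And>h :: complex^'n^'n. norm h < d1 \<Longrightarrow> (mat 1 + h) ** (mat 1 + h) = mat 1 \<Longrightarrow> h = 0"
      using square_near_one by blast
    obtain C where C: "C > 0" "\<And>y. norm (h y) \<le> norm y * C"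
      using bounded_linear.pos_bounded[OF h] by blast
    obtain C' where C': "C' > 0" "\<And>y. norm (\<theta> y) \<le> norm y * C'"
      using bounded_linear.pos_bounded[OF \<theta>] by blast
    \<comment> \<open>The first bound makes \<open>h y\<close> small enough for
      \<open>square_near_one\<close>; the second keeps n times the angle strictly between -pi and
      pi, where the only root of sin is 0.\<close>
    define d0 where "d0 = min (d1 / C) (pi / (C' * CARD('n)))"
    have "q1 \<in> reachable_set (\<lambda>u. (**) (X u)) G U q0"
    proof (rule reachable_if_dense[OF _ _ _ q1 w, where R=R and R'=R' and \<Lambda>=\<Lambda> and ?d0.0=d0])
      show "x ** y \<in> G" if "x \<in> S" "y \<in> G" for x y using that SG Gmult by blast
      show "adjoint_mat x ** y \<in> G" if "x \<in> S" "y \<in> G" for x y using that SG Gmult Gadj by blast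
      show "G \<subseteq> closure (reachable_set (\<lambda>u. (**) (X u)) G U q0)"
        using approx q0 by (simp add: approximately_controllable_def)
      show "continuous_on UNIV R" unfolding R_def[abs_def]
        by (intro mm.continuous_on continuous_intros bounded_linear.continuous_on[OF \<theta>] bounded_linear.continuous_on[OF h])
      show "R 0 = mat 1" by (simp add: R_def zero)
      have "((\<lambda>y. cos (\<theta> y) *\<^sub>R mat 1 + sin (\<theta> y) *\<^sub>R mat \<i> :: complex^'n^'n) has_derivative
          (\<lambda>y. \<theta> y *\<^sub>R mat \<i>)) (at 0)"
        by (rule derivative_eq_intros bounded_linear_imp_has_derivative[OF \<theta>] refl)+ (simp add: zero)
      moreover have "((\<lambda>y. mat 1 + h y) has_derivative h) (at 0)"
        by (rule derivative_eq_intros bounded_linear_imp_has_derivative[OF h] refl)+ simp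
      ultimately show "(R has_derivative R') (at 0)"
        using mm.FDERIV[of "\<lambda>y. cos (\<theta> y) *\<^sub>R mat 1 + sin (\<theta> y) *\<^sub>R mat \<i>" _ 0 UNIV "\<lambda>y. mat 1 + h y" h]
        by (simp add: R_def[abs_def] R'_def[abs_def] zero)
      show "linear \<Lambda>" unfolding \<Lambda>_def[abs_def]
        by (intro bounded_linear.linear bounded_linear_sub bounded_linear_scaleR_const \<theta> k)
      \<comment> \<open>In the trace-free case the division by n in \<open>\<theta>\<close> makes
        the trace of the phase term equal to that of \<open>k y\<close>, so
        \<open>\<Lambda> y\<close> has trace 0.\<close>
      show "\<Lambda> y \<in> W" for y
      proof (cases "\<forall>u\<in>U. trace (X u) = 0")
        case True
        have "trace (k y) = \<i> * Im (trace (D y))"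
        proof -
          have "2 * trace (k y) = trace (2 *\<^sub>R k y)" by (simp add: trace_def sum_distrib_left scaleR_conv_of_real)
          also have "\<dots> = trace (D y) - cnj (trace (D y))"
            by (simp add: k_def trace_sub trace_adjoint_mat)
          finally show ?thesis by (simp add: complex_eq_iff)
        qed
        moreover have "trace (\<theta> y *\<^sub>R mat \<i> :: complex^'n^'n) = \<i> * Im (trace (D y))"
        proof -
          have "\<theta> y *\<^sub>R mat \<i> = (mat (\<theta> y *\<^sub>R \<i>) :: complex^'n^'n)" by (simp add: vec_eq_iff mat_def)
          moreover have "\<kappa> = 1" unfolding \<kappa>_def using True by (rule if_P)
          ultimately show ?thesis by (simp add: trace_mat \<theta>_def scaleR_conv_of_real)
        qed
        ultimately have "trace (\<Lambda> y) = 0" by (simp add: \<Lambda>_def trace_sub)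
        then show ?thesis using traceless_skew_in_W[OF SUK skew\<Lambda>] True by blast
      next
        case False
        then show ?thesis using skew_in_W[OF SUK skew\<Lambda>] by blast
      qed
      show "(R' y - \<Lambda> y) ** (adjoint_mat g ** q1) = y" for y
      proof -
        have "R' y - \<Lambda> y = h y + k y" by (simp add: R'_def \<Lambda>_def)
        also have "\<dots> = D y" by (simp add: h_def k_def algebra_simps flip: scaleR_2)
        finally show ?thesis
          using unitary_cancel(1)[OF \<psi>] by (simp add: D_def \<psi>_def flip: matrix_mul_assoc)
      qed
      show "d0 > 0" using d1 C C' by (simp add: d0_def)
      show "R y ** z = z" if y: "norm y < d0" and z: "z \<in> G" "R y ** z \<in> G" for y z
      proof -
        have "R y ** z ** adjoint_mat z \<in> G" by (rule Gmult[OF z(2) Gadj[OF z(1)]])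
        moreover have "z ** adjoint_mat z = mat 1" using unitary_cancel(2) z(1) GU by blast
        ultimately have RG: "R y \<in> G" by (simp flip: matrix_mul_assoc)
        then have RU: "adjoint_mat (R y) ** R y = mat 1" using GU unitary_group_iff by blast
        define c where "c = cis (\<theta> y)"
        have Rc: "R y = mat c ** (mat 1 + h y)"
        proof -
          have "cos (\<theta> y) *\<^sub>R mat 1 + sin (\<theta> y) *\<^sub>R mat \<i> = (mat c :: complex^'n^'n)"
            by (simp add: vec_eq_iff mat_def c_def complex_eq_iff)
          then show ?thesis by (simp add: R_def)
        qed
        have "mat (cnj c) ** mat c = (mat 1 :: complex^'n^'n)"
          by (simp add: vec_eq_iff mat_mult_nth) (simp add: mat_def c_def cis_cnj cis_mult)
        moreover have "adjoint_mat (R y) = (mat 1 + h y) ** mat (cnj c)"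
          by (simp add: Rc adjoint_mat_mult adj_add adjh)
        \<comment> \<open>The phase cancels against its conjugate and \<open>mat 1 + h y\<close> is
          Hermitian, so unitarity of \<open>R y\<close> says that its square is the
          identity.\<close>
        ultimately have "adjoint_mat (R y) ** R y = (mat 1 + h y) ** (mat 1 + h y)"
          unfolding Rc by (metis matrix_mul_assoc matrix_mul_lid)
        moreover have "norm (h y) < d1"
        proof -
          have "norm y * C < d1" using y C(1) by (simp add: d0_def pos_less_divide_eq)
          then show ?thesis using C(2)[of y] by linarith
        qed
        ultimately have "h y = 0" using d1(2) RU by simp
        then have Rc': "R y = mat c" by (simp add: Rc)
        have "\<theta> y = 0"
        proof (cases "\<forall>u\<in>U. trace (X u) = 0")
          case True
          then have "c ^ CARD('n) = 1" using RG by (simp add: G special_unitary_group_def Rc' det_mat)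
          then have "cis (real CARD('n) * \<theta> y) = 1" unfolding c_def Complex.DeMoivre .
          then have sin0: "sin (real CARD('n) * \<theta> y) = 0" by (simp add: complex_eq_iff)
          have "\<bar>real CARD('n) * \<theta> y\<bar> < pi"
          proof -
            have "norm y * (C' * CARD('n)) < pi" using y C'(1) by (simp add: d0_def pos_less_divide_eq)
            moreover have "\<bar>real CARD('n) * \<theta> y\<bar> \<le> norm y * (C' * CARD('n))"
              using mult_right_mono[OF C'(2)[of y], of "real CARD('n)"] by (simp add: abs_mult mult_ac)
            ultimately show ?thesis by linarith
          qed
          then have "real CARD('n) * \<theta> y = 0" by (intro sin_eq_0_pi[OF _ _ sin0]) linarith+
          then show ?thesis by simp
        next
          case False
          then have "\<kappa> = 0" unfolding \<kappa>_def by (rule if_not_P)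
          then show ?thesis by (simp add: \<theta>_def)
        qed
        then show ?thesis by (simp add: Rc' c_def)
      qed
    qed
    then show ?thesis by simp
  qed
  moreover have "reachable_set (\<lambda>u g. X u ** g) G U q0 \<subseteq> G" for q0
    by (auto simp: reachable_set_def is_solution_def)
  ultimately show ?thesis unfolding exactly_controllable_def by blast
qed

section \<open>Controllability on the sphere\<close>

lemma mat_i_mat_i: "mat \<i> *v (mat \<i> *v x) = - x" for x :: "complex^'n"
  by (simp add: mat_vector_mult vec_eq_iff)

text \<open>The first-order condition at a minimum of a quadratic: at s = -b/(c+1) the expression
  equals -s^2 (c+2).\<close>

lemma linear_coeff_zero:
  fixes b c :: real
  assumes c: "c \<ge> 0" and nonneg: "\<And>t. 2 * t * b + t\<^sup>2 * c \<ge> 0"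
  shows "b = 0"
proof (rule ccontr)
  assume "b \<noteq> 0"
  define s where "s = - b / (c + 1)"
  have s: "s * (c + 1) = - b" using c by (simp add: s_def)
  then have "s \<noteq> 0" using \<open>b \<noteq> 0\<close> by auto
  have "2 * s * b + s\<^sup>2 * c = - (s\<^sup>2 * (c + 2))"
    using s by (auto simp: power2_eq_square algebra_simps) algebra
  moreover have "s\<^sup>2 * (c + 2) > 0" using \<open>s \<noteq> 0\<close> c by (intro mult_pos_pos) auto
  ultimately show False using nonneg[of s] by linarith
qed

text \<open>A unit vector maximizing |Ax|, with maximum m, satisfies A(A\<psi>) = -m^2 \<psi>. Thus
  (A - im)(A + im)\<psi> = 0, and either \<psi> or (A + im)\<psi> is an eigenvector.\<close>

lemma skew_eigenvector:
  fixes A :: "complex^'n^'n"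
  assumes A: "skew_hermitian A" "A \<noteq> 0"
  shows "\<exists>\<psi> l. norm \<psi> = 1 \<and> l \<noteq> 0 \<and> A *v \<psi> = l *\<^sub>R (mat \<i> *v \<psi>)"
proof -
  have "continuous_on (sphere 0 1) (\<lambda>x. norm (A *v x))"
    by (intro continuous_intros mv.continuous_on)
  moreover have "sphere (0 :: complex^'n) 1 \<noteq> {}" by simp
  ultimately obtain \<psi> where \<psi>: "norm \<psi> = 1" "\<And>x. norm x = 1 \<Longrightarrow> norm (A *v x) \<le> norm (A *v \<psi>)"
    using continuous_attains_sup[of "sphere (0 :: complex^'n) 1" "\<lambda>x. norm (A *v x)"] by auto
  define m where "m = norm (A *v \<psi>)"
  have bound: "norm (A *v x) \<le> m * norm x" for x
  proof (cases "x = 0")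
    case False
    have "norm (A *v ((1 / norm x) *\<^sub>R x)) \<le> m" unfolding m_def using False by (intro \<psi>(2)) simp
    then show ?thesis using False by (simp add: mv.scaleR_right field_simps)
  qed simp
  have "m > 0"
  proof (rule ccontr)
    assume "\<not> m > 0"
    then have "m = 0" by (simp add: m_def)
    then have "A *v x = 0 *v x" for x using bound[of x] by simp
    then show False using A(2) by (metis matrix_eq)
  qed
  have AA: "A *v (A *v \<psi>) = - (m\<^sup>2 *\<^sub>R \<psi>)"
  proof -
    have "(A *v (A *v \<psi>)) \<bullet> y = (- (m\<^sup>2 *\<^sub>R \<psi>)) \<bullet> y" for y
    proof -
      \<comment> \<open>\<open>b\<close> and \<open>c\<close> are the coefficients of the quadratic
        form m^2 |x|^2 - |Ax|^2 along the line \<psi> + t y; the form is nonnegative and vanishes at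
        \<psi>.\<close>
      define b where "b = m\<^sup>2 * (\<psi> \<bullet> y) - (A *v \<psi>) \<bullet> (A *v y)"
      define c where "c = m\<^sup>2 * (y \<bullet> y) - (A *v y) \<bullet> (A *v y)"
      have Q: "m\<^sup>2 * (x \<bullet> x) - (A *v x) \<bullet> (A *v x) \<ge> 0" for x
        using power_mono[OF bound[of x], of 2] by (simp add: power_mult_distrib power2_norm_eq_inner)
      have "2 * t * b + t\<^sup>2 * c \<ge> 0" for t
      proof -
        have "(A *v \<psi>) \<bullet> (A *v \<psi>) = m\<^sup>2 * (\<psi> \<bullet> \<psi>)"
          using \<psi>(1) by (simp add: m_def dot_square_norm)
        moreover have "A *v (\<psi> + t *\<^sub>R y) = A *v \<psi> + t *\<^sub>R (A *v y)" by (simp add: mv.add_right mv.scaleR_right)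
        ultimately show ?thesis
          using Q[of "\<psi> + t *\<^sub>R y"]
          by (simp add: b_def c_def inner_add_left inner_add_right power2_eq_square algebra_simps inner_commute)
      qed
      moreover have "c \<ge> 0" using Q by (simp add: c_def)
      ultimately have "b = 0" by (intro linear_coeff_zero[of c b])
      moreover have "(A *v (A *v \<psi>)) \<bullet> y = - ((A *v \<psi>) \<bullet> (A *v y))"
        using A(1) by (simp add: inner_matrix_vector_mult[of A "A *v \<psi>"] skew_hermitian_def mv.minus_left)
      ultimately show ?thesis by (simp add: b_def)
    qed
    then show ?thesis by (rule vector_eq_rdot[THEN iffD1, OF allI])
  qed
  define \<xi> where "\<xi> = A *v \<psi> + m *\<^sub>R (mat \<i> *v \<psi>)"
  show ?thesis
  proof (cases "\<xi> = 0")
    case True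
    then have "A *v \<psi> = (- m) *\<^sub>R (mat \<i> *v \<psi>)" by (simp add: \<xi>_def add_eq_0_iff2)
    then show ?thesis using \<psi>(1) \<open>m > 0\<close> by (intro exI[of _ \<psi>] exI[of _ "- m"]) auto
  next
    case False
    have Ai: "A *v (mat \<i> *v x) = mat \<i> *v (A *v x)" for x
      by (simp add: matrix_vector_mul_assoc mat_mult_commute)
    have "A *v \<xi> = m *\<^sub>R (mat \<i> *v \<xi>)"
      by (simp add: \<xi>_def mv.add_right mv.scaleR_right AA Ai mat_i_mat_i power2_eq_square algebra_simps)
    then have "A *v ((1 / norm \<xi>) *\<^sub>R \<xi>) = m *\<^sub>R (mat \<i> *v ((1 / norm \<xi>) *\<^sub>R \<xi>))"
      by (simp add: mv.scaleR_right)
    then show ?thesis using False \<open>m > 0\<close>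
      by (intro exI[of _ "(1 / norm \<xi>) *\<^sub>R \<xi>"] exI[of _ m]) auto
  qed
qed

lemma orthogonal_projection:
  fixes V :: "'a::euclidean_space set"
  assumes V: "subspace V"
  obtains P where "bounded_linear P" "\<And>x. P x \<in> V" "\<And>a c. a \<in> V \<Longrightarrow> (\<And>b. b \<in> V \<Longrightarrow> c \<bullet> b = 0) \<Longrightarrow> P (a + c) = a"
    "\<And>x b. b \<in> V \<Longrightarrow> (x - P x) \<bullet> b = 0"
proof -
  obtain B where B: "B \<subseteq> V" "pairwise orthogonal B" "\<And>x. x \<in> B \<Longrightarrow> norm x = 1" "independent B" "span B = V"
    using orthonormal_basis_subspace[OF V] by metis
  have fin: "finite B" using B(4) by (rule independent_imp_finite)
  define P where "P x = (\<Sum>b\<in>B. (x \<bullet> b) *\<^sub>R b)" for x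
  have PV: "P x \<in> V" for x unfolding P_def using B(1) V by (intro subspace_sum subspace_scale) auto
  have orthB: "(x - P x) \<bullet> b = 0" if "b \<in> B" for x b
  proof -
    have "P x \<bullet> b = (\<Sum>b'\<in>B. if b' = b then x \<bullet> b else 0)"
      unfolding P_def inner_sum_left
    proof (rule sum.cong[OF refl])
      fix b' assume "b' \<in> B"
      then show "((x \<bullet> b') *\<^sub>R b') \<bullet> b = (if b' = b then x \<bullet> b else 0)"
        using that B(2,3) by (auto simp: pairwise_def orthogonal_def dot_square_norm)
    qed
    then show ?thesis using fin that by (simp add: inner_diff_left)
  qed
  have orth: "(x - P x) \<bullet> b = 0" if "b \<in> V" for x b
  proof -
    have "orthogonal (x - P x) b"
      using that orthB B(5) by (intro orthogonal_to_span[of b B]) (auto simp: orthogonal_def)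
    then show ?thesis by (simp add: orthogonal_def)
  qed
  have "P (a + c) = a" if "a \<in> V" "\<And>b. b \<in> V \<Longrightarrow> c \<bullet> b = 0" for a c
  proof -
    define e where "e = a - P (a + c)"
    have "e \<in> V" unfolding e_def using that(1) PV V by (intro subspace_diff)
    moreover have "e \<bullet> e = (a + c - P (a + c)) \<bullet> e - c \<bullet> e"
      by (simp add: e_def algebra_simps)
    ultimately have "e \<bullet> e = 0" using orth[of e "a + c"] that(2)[of e] by simp
    then show ?thesis by (simp add: e_def)
  qed
  moreover have "bounded_linear P"
    unfolding P_def[abs_def] by (intro bounded_linear_sum bounded_linear_scaleR_const bounded_linear_inner_left)
  ultimately show ?thesis using that PV orth by blast
qed

lemma adjoint_matexp:
  assumes "skew_hermitian Z"
  shows "adjoint_mat (matexp Z t) = matexp Z (- t)"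
proof -
  have "matexp Z t ** matexp Z (- t) = mat 1" using matexp_add[OF assms, of t "- t"] by simp
  then show ?thesis
    using unitary_cancel(3)[OF matexp_unitary[OF assms, of t], of "matexp Z (- t)"] by simp
qed

section \<open>The normalizer of the span when \<open>K\<close> is transitive\<close>

context skew_system
begin

text \<open>Bracketing with \<open>Z\<close> preserves \<open>W\<close> and, being skew, its
  orthogonal complement, so it commutes with the projection \<open>P\<close>. Hence
  \<open>P (M t)\<close> and \<open>M t\<close> solve the same linear equation with the same initial
  value and coincide.\<close>

lemma matexp_normalizes_W:
  assumes Z: "skew_hermitian Z" and ZW: "\<And>A. A \<in> W \<Longrightarrow> lie_bracket Z A \<in> W" and A: "A \<in> W"
  shows "matexp Z t ** A ** adjoint_mat (matexp Z t) \<in> W"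
proof -
  obtain P where P: "bounded_linear P" "\<And>x. P x \<in> W"
    "\<And>a c. a \<in> W \<Longrightarrow> (\<And>b. b \<in> W \<Longrightarrow> c \<bullet> b = 0) \<Longrightarrow> P (a + c) = a"
    "\<And>x b. b \<in> W \<Longrightarrow> (x - P x) \<bullet> b = 0"
    using orthogonal_projection[OF subspace_W] by metis
  have Pcomm: "P (lie_bracket Z M) = lie_bracket Z (P M)" for M
  proof -
    have "lie_bracket Z M = lie_bracket Z (P M) + lie_bracket Z (M - P M)"
      by (simp add: lie_bracket_def mm.diff_left mm.diff_right)
    moreover have "lie_bracket Z (M - P M) \<bullet> b = 0" if "b \<in> W" for b
      using inner_lie_bracket[OF Z, of "M - P M" b] P(4)[OF ZW[OF that]] by simp
    ultimately show ?thesis using P(3)[OF ZW[OF P(2)]] by simp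
  qed
  define M where "M t = matexp Z t ** A ** adjoint_mat (matexp Z t)" for t
  have M: "(M has_vector_derivative lie_bracket Z (M t)) (at t)" for t
    unfolding M_def[abs_def] by (rule matexp_conj_has_vector_derivative[OF Z])
  \<comment> \<open>Conjugating back by the flow turns uniqueness for that linear equation into the
    constancy of \<open>N\<close>.\<close>
  define N where "N t = adjoint_mat (matexp Z t) ** (P (M t) ** matexp Z t)" for t
  have "(N has_vector_derivative 0) (at t)" for t
  proof -
    have PM: "((\<lambda>t. P (M t)) has_vector_derivative lie_bracket Z (P (M t))) (at t)"
      using bounded_linear.has_vector_derivative[OF P(1) M] by (simp add: Pcomm)
    have "(N has_vector_derivative (adjoint_mat (matexp Z t) **
        (P (M t) ** (Z ** matexp Z t) + lie_bracket Z (P (M t)) ** matexp Z t)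
        + - (adjoint_mat (matexp Z t) ** Z) ** (P (M t) ** matexp Z t))) (at t)"
      unfolding N_def[abs_def]
      by (intro mm.has_vector_derivative adjoint_matexp_has_vector_derivative[OF Z] PM
          matexp_has_vector_derivative)
    then show ?thesis
      by (simp add: lie_bracket_def mm.minus_left mm.diff_left mm.diff_right mm.add_right matrix_mul_assoc)
  qed
  from constant_if_vector_derivative_0[OF this, of t 0]
  have "N t = P A" by (simp add: N_def M_def)
  also have "\<dots> = A" using P(3)[OF A, of 0] by simp
  finally have "matexp Z t ** N t ** adjoint_mat (matexp Z t) = M t" by (simp add: M_def)
  then have "P (M t) = M t"
    using unitary_cancel[OF matexp_unitary[OF Z, of t]] by (simp add: N_def flip: matrix_mul_assoc)
  then show ?thesis using P(2)[of "M t"] by (simp add: M_def)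
qed

text \<open>\<open>K\<close> commutes with \<open>Y\<close> by its definition and moves one
  eigenvector to every unit vector, so all unit vectors share its eigenvalue.\<close>

lemma schur_skew:
  assumes trans: "\<And>x y. norm x = 1 \<Longrightarrow> norm y = 1 \<Longrightarrow> \<exists>g\<in>K. g *v x = y"
    and Y: "skew_hermitian Y" "\<And>A. A \<in> W \<Longrightarrow> Y ** A = A ** Y"
  shows "\<exists>l. Y = l *\<^sub>R mat \<i>"
proof (cases "Y = 0")
  case True
  then show ?thesis by (intro exI[of _ 0]) simp
next
  case False
  then obtain \<psi> l where \<psi>: "norm \<psi> = 1" "Y *v \<psi> = l *\<^sub>R (mat \<i> *v \<psi>)"
    using skew_eigenvector[OF Y(1)] by blast
  have unit: "Y *v y = l *\<^sub>R (mat \<i> *v y)" if y: "norm y = 1" for y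
  proof -
    obtain g where g: "g \<in> K" "g *v \<psi> = y" using trans[OF \<psi>(1) y] by blast
    have "Y *v y = g *v (Y *v \<psi>)"
      using K_commute[OF g(1) Y(2)] g(2) by (metis matrix_vector_mul_assoc)
    also have "\<dots> = l *\<^sub>R (g *v (mat \<i> *v \<psi>))" by (simp add: \<psi> mv.scaleR_right)
    also have "g *v (mat \<i> *v \<psi>) = mat \<i> *v y"
      unfolding g(2)[symmetric] by (simp add: matrix_vector_mul_assoc mat_mult_commute)
    finally show ?thesis .
  qed
  have "Y *v y = (l *\<^sub>R mat \<i>) *v y" for y
  proof (cases "y = 0")
    case False
    have "Y *v ((1 / norm y) *\<^sub>R y) = l *\<^sub>R (mat \<i> *v ((1 / norm y) *\<^sub>R y))"
      using False by (intro unit) simp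
    from arg_cong[OF this, of "\<lambda>x. norm y *\<^sub>R x"]
    show ?thesis using False by (simp add: mv.scaleR_left mv.scaleR_right)
  qed simp
  then show ?thesis by (metis matrix_eq)
qed

lemma normalizer_W:
  assumes trans: "\<And>x y. norm x = 1 \<Longrightarrow> norm y = 1 \<Longrightarrow> \<exists>g\<in>K. g *v x = y"
    and Z: "skew_hermitian Z" and ZW: "\<And>A. A \<in> W \<Longrightarrow> lie_bracket Z A \<in> W"
  obtains P l where "P \<in> W" "Z = P + l *\<^sub>R mat \<i>"
proof -
  obtain P Y where PY: "P \<in> W" "skew_hermitian Y" "\<And>B. B \<in> W \<Longrightarrow> Y \<bullet> B = 0" "Z = P + Y"
    using W_decomp[OF Z] by blast
  have "lie_bracket Y A \<in> W" if "A \<in> W" for A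
  proof -
    have "lie_bracket Y A = lie_bracket Z A - lie_bracket P A" by (simp add: PY(4) lie_bracket_simps)
    then show ?thesis using ZW[OF that] bracket_W[OF PY(1) that] subspace_W by (simp add: subspace_diff)
  qed
  then have "Y ** A = A ** Y" if "A \<in> W" for A using bracket_orthogonal_W[OF PY(3) _ that] by blast
  then obtain l where "Y = l *\<^sub>R mat \<i>" using schur_skew[OF trans PY(2)] by blast
  then show ?thesis using that PY by blast
qed

text \<open>The commutant condition does not follow from normalizing \<open>W\<close> alone; it
  holds because \<open>Z\<close> lies in \<open>W\<close> up to an imaginary scalar.\<close>

lemma matexp_normalizer_in_K:
  assumes trans: "\<And>x y. norm x = 1 \<Longrightarrow> norm y = 1 \<Longrightarrow> \<exists>g\<in>K. g *v x = y"
    and Z: "skew_hermitian Z" and ZW: "\<And>A. A \<in> W \<Longrightarrow> lie_bracket Z A \<in> W"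
  shows "matexp Z t \<in> K"
  unfolding K_def
proof (intro CollectI conjI ballI allI impI)
  show "matexp Z t \<in> unitary_group" by (rule matexp_unitary[OF Z])
  show "matexp Z t ** A ** adjoint_mat (matexp Z t) \<in> W" if "A \<in> W" for A
    by (rule matexp_normalizes_W[OF Z ZW that])
  show "adjoint_mat (matexp Z t) ** A ** matexp Z t \<in> W" if "A \<in> W" for A
    using matexp_normalizes_W[OF Z ZW that, of "- t"] by (simp add: adjoint_matexp[OF Z])
  fix Y assume Y: "\<forall>A\<in>W. Y ** A = A ** Y"
  obtain P l where P: "P \<in> W" "Z = P + l *\<^sub>R mat \<i>" using normalizer_W[OF trans Z ZW] by blast
  have "Z ** Y = Y ** Z"
    using Y P(1) unfolding P(2)
    by (simp add: mm.add_left mm.add_right mm.scaleR_left mm.scaleR_right mat_mult_commute)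
  then show "Y ** matexp Z t = matexp Z t ** Y" using matexp_commute[OF Z] by metis
qed

lemma ex_W_mult_i:
  assumes trans: "\<And>x y. norm x = 1 \<Longrightarrow> norm y = 1 \<Longrightarrow> \<exists>g\<in>K. g *v x = y"
    and n2: "CARD('n) \<ge> 2" and \<psi>: "norm \<psi> = 1"
  shows "\<exists>A\<in>W. A *v \<psi> = mat \<i> *v \<psi>"
proof -
  \<comment> \<open>If \<open>W\<close> were zero, every matrix would lie in its commutant, so
    elements of \<open>K\<close> would be scalars and could not carry one coordinate vector to
    another. Two distinct coordinates exist as n is at least 2.\<close>
  have "\<exists>A\<in>W. A \<noteq> 0"
  proof (rule ccontr)
    assume "\<not> (\<exists>A\<in>W. A \<noteq> 0)"
    then have W0: "A = 0" if "A \<in> W" for A using that by blast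
    obtain a b :: 'n where ab: "a \<noteq> b"
      using n2 card_le_Suc0_iff_eq[of "UNIV :: 'n set"] by (auto simp: numeral_2_eq_2)
    obtain g where g: "g \<in> K" "g *v axis a 1 = axis b (1 :: complex)"
      using trans[of "axis a 1" "axis b 1"] by auto
    have "Y ** g = g ** Y" for Y
    proof (rule K_commute[OF g(1)])
      fix A assume "A \<in> W"
      then have "A = 0" by (rule W0)
      then show "Y ** A = A ** Y" by (simp add: mm.zero_left mm.zero_right)
    qed
    then obtain c where "g = mat c" using commute_all_scalar[of g] by metis
    then have "(axis b (1 :: complex)) $ b = c * (axis a 1) $ b" using g(2) by (simp add: mat_vector_mult flip: g(2))
    then show False using ab by (simp add: axis_def)
  qed
  then obtain A where A: "A \<in> W" "A \<noteq> 0" by blast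
  obtain \<psi>1 l where e: "norm \<psi>1 = 1" "l \<noteq> 0" "A *v \<psi>1 = l *\<^sub>R (mat \<i> *v \<psi>1)"
    using skew_eigenvector[OF W_skew[OF A(1)] A(2)] by blast
  obtain g where g: "g \<in> K" "g *v \<psi>1 = \<psi>" using trans[OF e(1) \<psi>] by blast
  define B where "B = (1 / l) *\<^sub>R (g ** A ** adjoint_mat g)"
  have "B \<in> W" unfolding B_def using K_conj(2)[OF g(1) A(1)] subspace_W by (rule subspace_scale[rotated])
  moreover have "B *v \<psi> = mat \<i> *v \<psi>"
  proof -
    have "adjoint_mat g *v \<psi> = \<psi>1" using unitary_cancel(5)[OF K_unitary[OF g(1)], of \<psi>1] g(2) by simp
    then have "(g ** A ** adjoint_mat g) *v \<psi> = g *v (A *v \<psi>1)" by (simp flip: matrix_vector_mul_assoc)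
    also have "\<dots> = l *\<^sub>R (mat \<i> *v \<psi>)"
      unfolding e(3) g(2)[symmetric] by (simp add: mv.scaleR_right matrix_vector_mul_assoc mat_mult_commute)
    finally show ?thesis using e(2) by (simp add: B_def mv.scaleR_left)
  qed
  ultimately show ?thesis by blast
qed

end

context skew_system
begin

text \<open>If \<open>v\<close> is normal to \<open>W \<psi>\<close>, pick \<open>h\<close> in \<open>K\<close> closest to the identity among those moving \<open>\<psi>\<close> a small step in
  direction \<open>v\<close>. A limit direction \<open>D\<close> of \<open>h - 1\<close> normalizes \<open>W\<close> and kills \<open>\<psi>\<close>, and minimality against
  \<open>h exp(tD)\<close> forces \<open>D = 0\<close>.\<close>

lemma normal_vector_zero:
  assumes trans: "\<And>x y. norm x = 1 \<Longrightarrow> norm y = 1 \<Longrightarrow> \<exists>g\<in>K. g *v x = y"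
    and n2: "CARD('n) \<ge> 2" and \<psi>: "norm \<psi> = 1"
    and v\<psi>: "v \<bullet> \<psi> = 0" and vW: "\<And>A. A \<in> W \<Longrightarrow> v \<bullet> (A *v \<psi>) = 0"
  shows "norm v \<noteq> 1"
proof
  assume v1: "norm v = 1"
  have dots: "v \<bullet> v = 1" "\<psi> \<bullet> \<psi> = 1" "\<psi> \<bullet> v = 0" "v \<bullet> \<psi> = 0"
    using v1 \<psi> v\<psi> by (simp_all add: dot_square_norm inner_commute)
  define s where "s k = 1 / real (Suc k)" for k
  have s: "0 < s k" "s k \<le> 1" for k by (simp_all add: s_def)
  have s0: "s \<longlonglongrightarrow> 0" unfolding s_def[abs_def] by (rule LIMSEQ_Suc[OF lim_1_over_n])
  define p where "p k = cos (s k) *\<^sub>R \<psi> + sin (s k) *\<^sub>R v" for k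
  have p1: "norm (p k) = 1" for k
  proof -
    have "p k \<bullet> p k = (cos (s k))\<^sup>2 + (sin (s k))\<^sup>2"
      by (simp add: p_def inner_add_left inner_add_right dots power2_eq_square)
    then show ?thesis by (simp add: norm_eq_sqrt_inner)
  qed
  have p0: "p \<longlonglongrightarrow> \<psi>"
  proof -
    have "(\<lambda>k. cos (s k) *\<^sub>R \<psi> + sin (s k) *\<^sub>R v) \<longlonglongrightarrow> cos 0 *\<^sub>R \<psi> + sin 0 *\<^sub>R v"
      by (intro tendsto_intros s0)
    then show ?thesis by (simp add: p_def[abs_def])
  qed
  define C where "C k = K \<inter> {g. g *v \<psi> = p k}" for k
  have "\<exists>h\<in>C k. \<forall>g\<in>C k. dist (mat 1) h \<le> dist (mat 1) g" for k
  proof -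
    have "closed (C k)"
      unfolding C_def by (intro closed_Int closed_K closed_Collect_eq mv.continuous_on continuous_intros)
    moreover have "C k \<noteq> {}" using trans[OF \<psi> p1] by (auto simp: C_def)
    ultimately show ?thesis by (rule distance_attains_inf) blast
  qed
  then obtain h where h: "\<And>k. h k \<in> C k" "\<And>k g. g \<in> C k \<Longrightarrow> dist (mat 1) (h k) \<le> dist (mat 1) g"
    by metis
  have hK: "h k \<in> K" "h k *v \<psi> = p k" for k using h(1)[of k] by (auto simp: C_def)
  obtain l r where l: "l \<in> K" and r: "strict_mono r" and lim: "(h \<circ> r) \<longlonglongrightarrow> l"
    using compact_K hK(1) unfolding compact_def by (metis comp_def)
  have pr: "(p \<circ> r) \<longlonglongrightarrow> \<psi>" using LIMSEQ_subseq_LIMSEQ[OF p0 r] .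
  have "(\<lambda>k. h (r k) *v \<psi>) \<longlonglongrightarrow> l *v \<psi>" using lim by (intro mv.tendsto tendsto_intros) (simp add: o_def)
  then have "l *v \<psi> = \<psi>" using pr LIMSEQ_unique by (auto simp: hK o_def)
  then have l\<psi>: "adjoint_mat l *v \<psi> = \<psi>" using unitary_cancel(5)[OF K_unitary[OF l], of \<psi>] by simp
  \<comment> \<open>The limit \<open>l\<close> fixes \<psi>, so multiplying \<open>h (r k)\<close>
    by its adjoint gives a competitor in the same set; the competitors tend to the identity, and the
    minimizers are no farther away.\<close>
  have "(h \<circ> r) \<longlonglongrightarrow> mat 1"
  proof -
    have "h (r k) ** adjoint_mat l \<in> C (r k)" for k
      using K_mult[OF hK(1) K_adjoint_mat[OF l]] hK(2)
      by (simp add: C_def l\<psi> flip: matrix_vector_mul_assoc)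
    then have le: "dist (mat 1) (h (r k)) \<le> dist (mat 1) (h (r k) ** adjoint_mat l)" for k by (rule h(2))
    have "(\<lambda>k. dist (mat 1) (h (r k) ** adjoint_mat l)) \<longlonglongrightarrow> dist (mat 1) (l ** adjoint_mat l)"
      using lim by (intro tendsto_intros mm.tendsto) (simp add: o_def)
    then have "(\<lambda>k. dist (mat 1) (h (r k) ** adjoint_mat l)) \<longlonglongrightarrow> 0"
      using unitary_cancel(2)[OF K_unitary[OF l]] by simp
    then have "(\<lambda>k. dist (h (r k)) (mat 1)) \<longlonglongrightarrow> 0"
      by (rule tendsto_sandwich[OF _ _ tendsto_const, rotated 2]) (use le in \<open>auto simp: dist_commute\<close>)
    then show ?thesis by (subst tendsto_dist_iff) (simp add: o_def)
  qed
  define f where "f = h \<circ> r"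
  have f0: "f \<longlonglongrightarrow> mat 1" using \<open>(h \<circ> r) \<longlonglongrightarrow> mat 1\<close> by (simp add: f_def)
  have fne: "f k \<noteq> mat 1" for k
  proof
    assume "f k = mat 1"
    then have "p (r k) \<bullet> v = \<psi> \<bullet> v" using hK(2)[of "r k"] by (simp add: f_def)
    then have "sin (s (r k)) = 0" by (simp add: p_def inner_add_left dots)
    moreover have "sin (s (r k)) > 0" using s[of "r k"] pi_gt3 by (intro sin_gt_zero) linarith+
    ultimately show False by simp
  qed
  have "\<forall>k. (1 / norm (f k - mat 1)) *\<^sub>R (f k - mat 1) \<in> sphere 0 1"
    using fne by auto
  then obtain D r2 where D1: "D \<in> sphere 0 1" and r2: "strict_mono r2"
    and limD: "((\<lambda>k. (1 / norm (f k - mat 1)) *\<^sub>R (f k - mat 1)) \<circ> r2) \<longlonglongrightarrow> D"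
    by (rule seq_compactE[OF compact_imp_seq_compact[OF compact_sphere]])
  define F where "F k = f (r2 k)" for k
  define \<delta> where "\<delta> k = norm (F k - mat 1)" for k
  define E where "E k = (1 / \<delta> k) *\<^sub>R (F k - mat 1)" for k
  define \<sigma> where "\<sigma> k = s (r (r2 k))" for k
  have F0: "F \<longlonglongrightarrow> mat 1" using LIMSEQ_subseq_LIMSEQ[OF f0 r2] by (simp add: F_def[abs_def] o_def)
  have ED: "E \<longlonglongrightarrow> D" using limD by (simp add: E_def[abs_def] \<delta>_def F_def o_def)
  have \<delta>: "\<delta> k > 0" for k using fne by (simp add: \<delta>_def F_def)
  have FK: "F k \<in> K" for k by (simp add: F_def f_def hK)
  have FE: "F k - mat 1 = \<delta> k *\<^sub>R E k" for k using \<delta>[of k] by (simp add: E_def)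
  have Dskew: "skew_hermitian D"
  proof -
    \<comment> \<open>Unitarity of F reads (F - 1) + (F - 1)* = -(F - 1)(F - 1)*. The right side is
      of second order, so dividing by \<open>\<delta> k\<close> leaves a skew limit.\<close>
    have "E k + adjoint_mat (E k) = - ((F k - mat 1) ** adjoint_mat (E k))" for k
    proof -
      have "(F k - mat 1) + adjoint_mat (F k - mat 1) = - ((F k - mat 1) ** adjoint_mat (F k - mat 1))"
        using unitary_cancel(2)[OF K_unitary[OF FK]]
        by (simp add: adj_diff mm.diff_left mm.diff_right)
      then have "\<delta> k *\<^sub>R (E k + adjoint_mat (E k)) = \<delta> k *\<^sub>R (- ((F k - mat 1) ** adjoint_mat (E k)))"
        unfolding FE adj_scaleR by (simp add: mm.scaleR_right mm.scaleR_left scaleR_add_right)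
      then show ?thesis using \<delta>[of k] by (simp only: real_vector.scale_cancel_left) simp
    qed
    moreover have "(\<lambda>k. - ((F k - mat 1) ** adjoint_mat (E k))) \<longlonglongrightarrow> - ((mat 1 - mat 1) ** adjoint_mat D)"
      by (intro tendsto_intros mm.tendsto adj_tendsto F0 ED)
    moreover have "(\<lambda>k. E k + adjoint_mat (E k)) \<longlonglongrightarrow> D + adjoint_mat D"
      by (intro tendsto_intros adj_tendsto ED)
    ultimately have "D + adjoint_mat D = - ((mat 1 - mat 1) ** adjoint_mat D)"
      using LIMSEQ_unique by auto
    then show ?thesis by (simp add: skew_hermitian_def mm.zero_left add_eq_0_iff)
  qed
  have DW: "lie_bracket D A \<in> W" if A: "A \<in> W" for A
  proof -
    have "E k ** A ** adjoint_mat (F k) + A ** adjoint_mat (E k) \<in> W" for k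
    proof -
      have "F k ** A ** adjoint_mat (F k) - A \<in> W"
        using K_conj(2)[OF FK A] A subspace_W by (simp add: subspace_diff)
      moreover have "F k ** A ** adjoint_mat (F k) - A
          = \<delta> k *\<^sub>R (E k ** A ** adjoint_mat (F k) + A ** adjoint_mat (E k))"
      proof -
        have "F k ** A ** adjoint_mat (F k) - A
            = (F k - mat 1) ** A ** adjoint_mat (F k) + A ** adjoint_mat (F k - mat 1)"
          by (simp add: adj_diff mm.diff_left mm.diff_right)
        then show ?thesis unfolding FE by (simp add: adj_scaleR mm.scaleR_left mm.scaleR_right scaleR_add_right)
      qed
      ultimately have "(1 / \<delta> k) *\<^sub>R (\<delta> k *\<^sub>R (E k ** A ** adjoint_mat (F k) + A ** adjoint_mat (E k))) \<in> W"
        using subspace_W by (metis subspace_scale)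
      then show ?thesis using \<delta>[of k] by simp
    qed
    moreover have "(\<lambda>k. E k ** A ** adjoint_mat (F k) + A ** adjoint_mat (E k))
        \<longlonglongrightarrow> D ** A ** adjoint_mat (mat 1) + A ** adjoint_mat D"
      by (intro tendsto_intros mm.tendsto adj_tendsto F0 ED)
    ultimately have "D ** A ** adjoint_mat (mat 1) + A ** adjoint_mat D \<in> W"
      by (rule closed_sequentially[OF closed_subspace[OF subspace_W]])
    then show ?thesis using Dskew by (simp add: skew_hermitian_def lie_bracket_def mm.minus_right)
  qed
  have D\<psi>: "D *v \<psi> = 0"
  proof -
    have lim\<psi>: "(\<lambda>k. E k *v \<psi>) \<longlonglongrightarrow> D *v \<psi>" by (intro mv.tendsto ED tendsto_const)
    \<comment> \<open>These vectors stay in the plane of \<psi> and v, so the limit vanishes once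
      both components do: along \<psi> because \<open>D\<close> is skew, along v because D\<psi>
      lies in W\<psi>, which contains i\<psi>.\<close>
    have E\<psi>: "E k *v \<psi> = ((cos (\<sigma> k) - 1) / \<delta> k) *\<^sub>R \<psi> + (sin (\<sigma> k) / \<delta> k) *\<^sub>R v" for k
    proof -
      have "(F k - mat 1) *v \<psi> = (cos (\<sigma> k) - 1) *\<^sub>R \<psi> + sin (\<sigma> k) *\<^sub>R v"
        using hK(2)[of "r (r2 k)"] by (simp add: mv.diff_left F_def f_def \<sigma>_def p_def algebra_simps)
      then show ?thesis by (simp add: E_def mv.scaleR_left scaleR_add_right)
    qed
    obtain P c where P: "P \<in> W" "D = P + c *\<^sub>R mat \<i>" using normalizer_W[OF trans Dskew DW] by blast
    obtain A where A: "A \<in> W" "A *v \<psi> = mat \<i> *v \<psi>" using ex_W_mult_i[OF trans n2 \<psi>] by blast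
    have "D *v \<psi> = P *v \<psi> + c *\<^sub>R (A *v \<psi>)" by (simp add: P(2) A(2) mv.add_left mv.scaleR_left)
    then have vD: "v \<bullet> (D *v \<psi>) = 0" using vW[OF P(1)] vW[OF A(1)] by (simp add: inner_add_right)
    have \<psi>D: "\<psi> \<bullet> (D *v \<psi>) = 0" using skew_hermitian_inner_zero[OF Dskew] by (simp add: inner_commute)
    have "(\<lambda>k. v \<bullet> (E k *v \<psi>)) \<longlonglongrightarrow> 0" "(\<lambda>k. \<psi> \<bullet> (E k *v \<psi>)) \<longlonglongrightarrow> 0"
      using tendsto_inner[OF tendsto_const lim\<psi>, of v] tendsto_inner[OF tendsto_const lim\<psi>, of \<psi>] vD \<psi>D by simp_all
    then have "(\<lambda>k. sin (\<sigma> k) / \<delta> k) \<longlonglongrightarrow> 0" "(\<lambda>k. (cos (\<sigma> k) - 1) / \<delta> k) \<longlonglongrightarrow> 0"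
      by (simp_all add: E\<psi> inner_add_right dots)
    then have "(\<lambda>k. E k *v \<psi>) \<longlonglongrightarrow> 0 *\<^sub>R \<psi> + 0 *\<^sub>R v"
      unfolding E\<psi> by (intro tendsto_intros)
    then show ?thesis using lim\<psi> LIMSEQ_unique by fastforce
  qed
  have expK: "matexp D t \<in> K" for t by (rule matexp_normalizer_in_K[OF trans Dskew DW])
  have exp\<psi>: "matexp D t *v \<psi> = \<psi>" for t
  proof -
    have "((\<lambda>t. matexp D t *v \<psi>) has_vector_derivative 0) (at t)" for t
    proof -
      have "D ** matexp D t = matexp D t ** D" using matexp_commute[OF Dskew refl] by simp
      then have "(D ** matexp D t) *v \<psi> = 0" by (simp add: D\<psi> flip: matrix_vector_mul_assoc)
      then show ?thesis
        using bounded_linear.has_vector_derivative[OF mv.bounded_linear_left[of \<psi>] matexp_has_vector_derivative[of D t]]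
        by simp
    qed
    from constant_if_vector_derivative_0[OF this, of t 0] show ?thesis by simp
  qed
  \<comment> \<open>\<open>F k ** matexp D t\<close> still moves \<psi> to the same point and has
    the same norm as \<open>F k\<close>, so least distance to the identity means greatest inner
    product with it; this is the first-order condition at t = 0.\<close>
  have FD: "(F k ** D) \<bullet> mat 1 = 0" for k
  proof -
    define \<phi> where "\<phi> t = (F k ** matexp D t) \<bullet> (mat 1 :: complex^'n^'n)" for t
    have le: "\<phi> t \<le> \<phi> 0" for t
    proof -
      have "F k ** matexp D t \<in> C (r (r2 k))"
        using K_mult[OF FK expK] hK(2)[of "r (r2 k)"]
        by (simp add: C_def exp\<psi> F_def f_def flip: matrix_vector_mul_assoc)
      then have "dist (mat 1) (F k) \<le> dist (mat 1) (F k ** matexp D t)"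
        using h(2) by (simp add: F_def f_def)
      then have "(dist (F k) (mat 1))\<^sup>2 \<le> (dist (F k ** matexp D t) (mat 1))\<^sup>2"
        by (intro power_mono) (simp_all add: dist_commute)
      moreover have "norm (F k ** matexp D t) = norm (F k)"
        by (rule norm_unitary_right[OF K_unitary[OF expK]])
      moreover have "(dist A (mat 1))\<^sup>2 = (norm A)\<^sup>2 - 2 * (A \<bullet> mat 1) + (norm (mat 1 :: complex^'n^'n))\<^sup>2"
        for A :: "complex^'n^'n"
        by (simp add: dist_norm power2_norm_eq_inner inner_diff_left inner_diff_right inner_commute)
      ultimately show ?thesis by (simp add: \<phi>_def)
    qed
    have "(\<phi> has_vector_derivative (F k ** (D ** matexp D 0)) \<bullet> mat 1) (at 0)"
      unfolding \<phi>_def[abs_def]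
      by (intro bounded_linear.has_vector_derivative[OF bounded_linear_inner_left]
          bounded_linear.has_vector_derivative[OF mm.bounded_linear_right] matexp_has_vector_derivative)
    then have "DERIV \<phi> 0 :> (F k ** D) \<bullet> mat 1"
      by (simp add: has_real_derivative_iff_has_vector_derivative)
    then show ?thesis using le by (intro DERIV_local_max[of \<phi> _ 0 1]) auto
  qed
  \<comment> \<open>With this, \<open>F k\<close> may be replaced by \<open>F k - mat 1\<close>;
    after rescaling, the limit of the first-order conditions is -|D|^2 = 0, against |D| = 1.\<close>
  have trD: "D \<bullet> mat 1 = 0"
    using trace_skew[OF Dskew] by (simp add: inner_matrix complex_eq_iff)
  have "(E k ** D) \<bullet> mat 1 = 0" for k
  proof -
    have "((F k - mat 1) ** D) \<bullet> mat 1 = 0" using FD[of k] trD by (simp add: mm.diff_left inner_diff_left)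
    then show ?thesis by (simp add: E_def mm.scaleR_left)
  qed
  moreover have "(\<lambda>k. (E k ** D) \<bullet> mat 1) \<longlonglongrightarrow> (D ** D) \<bullet> mat 1"
    by (intro tendsto_intros mm.tendsto ED)
  ultimately have "(D ** D) \<bullet> mat 1 = 0" by (simp add: LIMSEQ_const_iff)
  moreover have "(D ** D) \<bullet> mat 1 = - (D \<bullet> D)"
    using Dskew by (simp add: inner_matrix_mult_left skew_hermitian_def)
  ultimately show False using D1 by simp
qed

text \<open>The component of \<open>t\<close> orthogonal to W\<psi> is also orthogonal to \<psi>,
  since skew matrices move \<psi> orthogonally to itself; normalized, it would be a forbidden unit
  normal.\<close>

lemma tangent_in_W:
  assumes trans: "\<And>x y. norm x = 1 \<Longrightarrow> norm y = 1 \<Longrightarrow> \<exists>g\<in>K. g *v x = y"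
    and n2: "CARD('n) \<ge> 2" and \<psi>: "norm \<psi> = 1" and t: "t \<bullet> \<psi> = 0"
  shows "\<exists>A\<in>W. A *v \<psi> = t"
proof -
  define V where "V = (\<lambda>A. A *v \<psi>) ` W"
  have V: "subspace V"
    unfolding V_def by (intro linear_subspace_image subspace_W bounded_linear.linear mv.bounded_linear_left)
  obtain p z where pz: "p \<in> span V" "\<And>w. w \<in> span V \<Longrightarrow> orthogonal z w" "t = p + z"
    using orthogonal_subspace_decomp_exists[of V t] by metis
  have spanV: "span V = V" using V by simp
  then obtain A where A: "A \<in> W" "p = A *v \<psi>" using pz(1) unfolding spanV V_def by blast
  have "z \<bullet> \<psi> = 0"
    using t skew_hermitian_inner_zero[OF W_skew[OF A(1)], of \<psi>] by (simp add: pz(3) A(2) inner_add_left)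
  have zW: "z \<bullet> (B *v \<psi>) = 0" if "B \<in> W" for B
    using pz(2)[of "B *v \<psi>"] that by (simp add: spanV) (simp add: V_def orthogonal_def)
  have "z = 0"
  proof (rule ccontr)
    assume "z \<noteq> 0"
    then have "norm ((1 / norm z) *\<^sub>R z) = 1" by simp
    moreover have "((1 / norm z) *\<^sub>R z) \<bullet> \<psi> = 0" using \<open>z \<bullet> \<psi> = 0\<close> by simp
    moreover have "((1 / norm z) *\<^sub>R z) \<bullet> (B *v \<psi>) = 0" if "B \<in> W" for B using zW[OF that] by simp
    ultimately show False using normal_vector_zero[OF trans n2 \<psi>] by blast
  qed
  then show ?thesis using A pz(3) by auto
qed

end

lemma sphere_exactly_controllable:
  fixes X :: "'u::euclidean_space \<Rightarrow> complex^'n^'n"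
  assumes n2: "CARD('n) \<ge> 2" and skew: "\<And>u. u \<in> U \<Longrightarrow> skew_hermitian (X u)"
    and approx: "approximately_controllable (\<lambda>u \<psi>. X u *v \<psi>) unit_sphere_C U"
  shows "exactly_controllable (\<lambda>u \<psi>. X u *v \<psi>) unit_sphere_C U"
proof -
  interpret skew_action X U "(*v) :: complex^'n^'n \<Rightarrow> complex^'n \<Rightarrow> complex^'n"
    by unfold_locales
      (auto intro: skew bounded_bilinear_matrix_vector_mult norm_unitary_vector simp: matrix_vector_mul_assoc)
  have trans: "\<exists>g\<in>K. g *v x = y" if "norm x = 1" "norm y = 1" for x y :: "complex^'n"
  proof -
    have "reachable_set (\<lambda>u \<psi>. X u *v \<psi>) unit_sphere_C U x \<subseteq> (\<lambda>g. g *v x) ` K"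
      using reachable_subset_orbit[of _ unit_sphere_C x] by auto
    moreover have "closed ((\<lambda>g. g *v x) ` K)"
      by (intro compact_imp_closed compact_continuous_image compact_K mv.continuous_on continuous_intros)
    ultimately have "closure (reachable_set (\<lambda>u \<psi>. X u *v \<psi>) unit_sphere_C U x) \<subseteq> (\<lambda>g. g *v x) ` K"
      by (rule closure_minimal)
    moreover have "y \<in> closure (reachable_set (\<lambda>u \<psi>. X u *v \<psi>) unit_sphere_C U x)"
      using approx that by (auto simp: approximately_controllable_def unit_sphere_C_def)
    ultimately show ?thesis by blast
  qed
  have "q1 \<in> reachable_set (\<lambda>u \<psi>. X u *v \<psi>) unit_sphere_C U q0"
    if q0: "q0 \<in> unit_sphere_C" and q1: "q1 \<in> unit_sphere_C" for q0 q1
  proof -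
    obtain g B where w: "word g B" "span B = W" using exists_spanning_word by blast
    define \<psi> where "\<psi> = adjoint_mat g *v q1"
    have gU: "g \<in> unitary_group" using S_unitary[OF word_in_S[OF w(1)]] .
    have \<psi>: "norm \<psi> = 1"
      unfolding \<psi>_def using norm_unitary_vector[OF unitary_adjoint_mat[OF gU]] q1 by (simp add: unit_sphere_C_def)
    \<comment> \<open>The right side is minus the tangential part of \<open>e\<close>; the sign
      compensates the one in \<open>R' y - \<Lambda> y\<close>.\<close>
    have "\<exists>A\<in>W. A *v \<psi> = (e \<bullet> \<psi>) *\<^sub>R \<psi> - e" for e
      using \<psi> by (intro tangent_in_W trans n2) (auto simp: inner_diff_left dot_square_norm)
    then obtain a where a: "\<And>e. a e \<in> W" "\<And>e. a e *v \<psi> = (e \<bullet> \<psi>) *\<^sub>R \<psi> - e" by metis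
    define \<Lambda> where "\<Lambda> y = (\<Sum>e\<in>Basis. (y \<bullet> e) *\<^sub>R a e)" for y :: "complex^'n"
    \<comment> \<open>The normal direction of the sphere is radial, so \<open>R\<close> is a
      dilation. It keeps a unit vector on the sphere only if the factor is 1 or -1, and -1 is
      excluded by \<open>norm y < 1\<close>.\<close>
    define R where "R y = (1 + y \<bullet> \<psi>) *\<^sub>R (mat 1 :: complex^'n^'n)" for y
    define R' where "R' y = (y \<bullet> \<psi>) *\<^sub>R (mat 1 :: complex^'n^'n)" for y
    have \<Lambda>\<psi>: "\<Lambda> y *v \<psi> = (y \<bullet> \<psi>) *\<^sub>R \<psi> - y" for y
    proof -
      have "\<Lambda> y *v \<psi> = (\<Sum>e\<in>Basis. (y \<bullet> e) *\<^sub>R ((e \<bullet> \<psi>) *\<^sub>R \<psi> - e))"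
        by (simp add: \<Lambda>_def mv.sum_left mv.scaleR_left a(2))
      also have "\<dots> = (\<Sum>e\<in>Basis. (y \<bullet> e) * (e \<bullet> \<psi>)) *\<^sub>R \<psi> - (\<Sum>e\<in>Basis. (y \<bullet> e) *\<^sub>R e)"
        by (simp add: scaleR_diff_right sum_subtractf scaleR_sum_left)
      also have "(\<Sum>e\<in>Basis. (y \<bullet> e) * (e \<bullet> \<psi>)) = y \<bullet> \<psi>"
        by (subst euclidean_inner[of y \<psi>], rule sum.cong) (simp_all add: inner_commute[of \<psi>])
      finally show ?thesis by (simp add: euclidean_representation)
    qed
    have "q1 \<in> reachable_set (\<lambda>u. (*v) (X u)) unit_sphere_C U q0"
    proof (rule reachable_if_dense[OF _ _ _ q1 w, where R=R and R'=R' and \<Lambda>=\<Lambda> and ?d0.0=1])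
      show "x *v y \<in> unit_sphere_C" if "x \<in> S" "y \<in> unit_sphere_C" for x y
        using that norm_unitary_vector[OF S_unitary] by (simp add: unit_sphere_C_def)
      show "adjoint_mat x *v y \<in> unit_sphere_C" if "x \<in> S" "y \<in> unit_sphere_C" for x y
        using that norm_unitary_vector[OF unitary_adjoint_mat[OF S_unitary]] by (simp add: unit_sphere_C_def)
      show "unit_sphere_C \<subseteq> closure (reachable_set (\<lambda>u. (*v) (X u)) unit_sphere_C U q0)"
        using approx q0 by (simp add: approximately_controllable_def)
      show "continuous_on UNIV R" unfolding R_def[abs_def] by (intro continuous_intros)
      show "R 0 = mat 1" by (simp add: R_def)
      show "(R has_derivative R') (at 0)"
        unfolding R_def[abs_def] R'_def[abs_def] by (auto intro!: derivative_eq_intros)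
      show "linear \<Lambda>" unfolding \<Lambda>_def[abs_def]
        by (intro bounded_linear.linear bounded_linear_sum bounded_linear_scaleR_const bounded_linear_inner_left)
      show "\<Lambda> y \<in> W" for y unfolding \<Lambda>_def using subspace_W a(1) by (intro subspace_sum subspace_scale)
      show "(R' y - \<Lambda> y) *v (adjoint_mat g *v q1) = y" for y
        unfolding \<psi>_def[symmetric] by (simp add: R'_def mv.diff_left mv.scaleR_left \<Lambda>\<psi>)
      show "R y *v z = z" if y: "norm y < 1" and z: "z \<in> unit_sphere_C" "R y *v z \<in> unit_sphere_C" for y z
      proof -
        have "\<bar>y \<bullet> \<psi>\<bar> < 1" using Cauchy_Schwarz_ineq2[of y \<psi>] y \<psi> by simp
        moreover have "\<bar>1 + y \<bullet> \<psi>\<bar> = 1"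
          using z by (simp add: unit_sphere_C_def R_def mv.scaleR_left)
        ultimately have "y \<bullet> \<psi> = 0" by linarith
        then show ?thesis by (simp add: R_def)
      qed
    qed simp
    then show ?thesis by simp
  qed
  moreover have "reachable_set (\<lambda>u \<psi>. X u *v \<psi>) unit_sphere_C U q0 \<subseteq> unit_sphere_C" for q0
    by (auto simp: reachable_set_def is_solution_def)
  ultimately show ?thesis unfolding exactly_controllable_def by blast
qed

lemma exactly_imp_approximately_controllable:
  "exactly_controllable f M U \<Longrightarrow> approximately_controllable f M U"
  using closure_subset by (auto simp: exactly_controllable_def approximately_controllable_def)

theorem theorem4p1:
  fixes U :: "(real^'m) set"
    and H :: "real^'m \<Rightarrow> complex^'n^'n"
  assumes n2: "CARD('n) \<ge> 2"
    and smooth: "smooth_on H U"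
    and herm: "\<forall>u\<in>U. hermitian (H u)"
  defines "G \<equiv> (if (\<forall>u\<in>U. trace (H u) = 0) then special_unitary_group else unitary_group)"
  shows "(approximately_controllable (\<lambda>u \<psi>. (- \<i>) *s (H u *v \<psi>)) unit_sphere_C U
           \<longleftrightarrow> exactly_controllable (\<lambda>u \<psi>. (- \<i>) *s (H u *v \<psi>)) unit_sphere_C U)
    \<and> (approximately_controllable (\<lambda>u g. mat (- \<i>) ** (H u ** g)) G U
           \<longleftrightarrow> exactly_controllable (\<lambda>u g. mat (- \<i>) ** (H u ** g)) G U)"
proof -
  define X where "X u = mat (- \<i>) ** H u" for u
  have skew: "skew_hermitian (X u)" if "u \<in> U" for u
  proof -
    have "adjoint_mat (H u) = H u" using herm that by (simp add: hermitian_def)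
    then show ?thesis
      by (simp add: skew_hermitian_def X_def adjoint_mat_mult mat_mult_commute[symmetric])
        (simp add: vec_eq_iff mat_mult_nth)
  qed
  have "trace (X u) = - \<i> * trace (H u)" for u
    by (simp add: X_def trace_def mat_mult_nth sum_distrib_left)
  then have G: "G = (if \<forall>u\<in>U. trace (X u) = 0 then special_unitary_group else unitary_group)"
    by (simp add: G_def)
  have sphere: "(\<lambda>u \<psi>. (- \<i>) *s (H u *v \<psi>)) = (\<lambda>u \<psi>. X u *v \<psi>)"
    by (simp add: X_def mat_vector_mult flip: matrix_vector_mul_assoc)
  have group: "(\<lambda>u g. mat (- \<i>) ** (H u ** g)) = (\<lambda>u (g :: complex^'n^'n). X u ** g)"
    by (simp add: X_def matrix_mul_assoc)
  show ?thesis
    unfolding sphere group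
    using sphere_exactly_controllable[OF n2 skew, of U] group_exactly_controllable[OF skew G]
    by (auto intro: exactly_imp_approximately_controllable)
qed

end
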